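(* Let $\alpha=3/7$, $\beta=4/7$, $\gamma=5/7$, and let $\mathcal{P}_{6,48}\subset\mathbb{R}^6$ be the convex hull of the following $48$ points: $P_{1} = (0, \gamma, \alpha, \beta, 0, 0)$, $P_{2} = (\alpha, 0, 0, -\gamma, -\beta, 0)$, $P_{3} = (\beta, \gamma, -\alpha, 0, 0, 0)$, $P_{4} = (-\beta, \gamma, -\alpha, 0, 0, 0)$, $P_{5} = (-\gamma, 0, 0, -\alpha, -\beta, 0)$, $P_{6} = (0, 0, \beta, 0, \alpha, -\gamma)$, $P_{7} = (0, 0, \beta, 0, -\gamma, -\alpha)$, $P_{8} = (-\gamma, 0, 0, -\alpha, \beta, 0)$, $P_{9} = (0, \beta, 0, 0, -\alpha, -\gamma)$, $P_{10} = (0, -\gamma, -\alpha, \beta, 0, 0)$, $P_{11} = (0, -\beta, 0, 0, \gamma, -\alpha)$, $P_{12} = (0, -\beta, 0, 0, -\gamma, \alpha)$, $P_{13} = (-\gamma, 0, 0, \alpha, 0, \beta)$, $P_{14} = (-\gamma, 0, 0, \alpha, 0, -\beta)$, $P_{15} = (0, 0, \beta, 0, -\alpha, \gamma)$, $P_{16} = (\alpha, 0, 0, \gamma, 0, \beta)$, $P_{17} = (0, \alpha, -\gamma, \beta, 0, 0)$, $P_{18} = (\alpha, 0, 0, -\gamma, \beta, 0)$, $P_{19} = (\beta, -\alpha, -\gamma, 0, 0, 0)$, $P_{20} = (0, \beta, 0, 0, \alpha, \gamma)$, $P_{21} = (0, 0, \beta, 0, \gamma, \alpha)$, $P_{22}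 = (\beta, \alpha, \gamma, 0, 0, 0)$, $P_{23} = (\alpha, 0, 0, \gamma, 0, -\beta)$, $P_{24} = (0, \alpha, -\gamma, -\beta, 0, 0)$, and $P_{i+24}=-P_i$ for $1\le i\le 24$. Then $\mathcal{P}_{6,48}$ is a centrally symmetric simplicial $6$-polytope, and the antipodal quotient of its boundary complex is a $24$-vertex triangulation of the real projective space $\mathbb{R}P^5$.
   Context: A polytope $P$ is centrally symmetric if $P=-P$; it is simplicial if every proper face is a simplex. The boundary complex $\partial P$ of a simplicial $d$-polytope is the simplicial complex of its proper faces, a simplicial $(d-1)$-sphere; for a centrally symmetric one, $v\mapsto -v$ is a free simplicial involution $\tau$. The antipodal quotient $\partial P/\tau$ is the complex obtained by identifying each vertex $v$ with $-v$ (and correspondingly each face $\sigma$ with $-\sigma$). A triangulation of a manifold $M$ is a simplicial complex whose geometric realization is homeomorphic to $M$. *)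

theory Defs
  imports "HOL-Analysis.Analysis"
begin

section \<open>Polytopes\<close>

definition centrally_symmetric :: "'a::real_vector set \<Rightarrow> bool" where
  "centrally_symmetric P \<longleftrightarrow> P = uminus ` P"

text \<open>The empty face is the simplex of dimension \<open>-1\<close>.\<close>

definition simplicial_polytope :: "'a::euclidean_space set \<Rightarrow> bool" where
  "simplicial_polytope P \<longleftrightarrow>
     polytope P \<and> (\<forall>F. F face_of P \<and> F \<noteq> P \<longrightarrow> (\<exists>n. n simplex F))"


section \<open>Finite abstract simplicial complexes and triangulations\<close>

text \<open>A complex is given by its set of faces; the empty face is allowed.\<close>

definition abstract_simplicial_complex :: "'v set set \<Rightarrow> bool" where
  "abstract_simplicial_complex K \<longleftrightarrow>
     finite K \<and> (\<forall>\<sigma>\<in>K. finite \<sigma>) \<and> (\<forall>\<sigma>\<in>K. \<forall>\<tau>. \<tau> \<subseteq> \<sigma> \<longrightarrow> \<tau> \<in> K)"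

definition complex_vertices :: "'v set set \<Rightarrow> 'v set" where
  "complex_vertices K = \<Union>K"

text \<open>The geometric realization in barycentric coordinates. On the function space \<open>'v \<Rightarrow> real\<close>
  the topology is the product topology; for a finite complex the subspace topology induced
  by it is the usual topology of the realization.\<close>

definition geometric_realization :: "'v set set \<Rightarrow> ('v \<Rightarrow> real) topology" where
  "geometric_realization K =
     top_of_set {x. (\<forall>v. 0 \<le> x v) \<and> {v. x v \<noteq> 0} \<in> K \<and> (\<Sum>v | x v \<noteq> 0. x v) = 1}"

definition triangulates :: "'v set set \<Rightarrow> 'b topology \<Rightarrow> bool" where
  "triangulates K X \<longleftrightarrow>
     abstract_simplicial_complex K \<and> geometric_realization K homeomorphic_space X"


section \<open>Boundary complexes and antipodal quotients\<close>

text \<open>For a simplicial polytope a proper face is recorded by its set of vertices.\<close>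

definition boundary_complex :: "'a::euclidean_space set \<Rightarrow> 'a set set" where
  "boundary_complex P = {{v. v extreme_point_of F} | F. F face_of P \<and> F \<noteq> P}"

definition antipodal_class :: "'a::uminus \<Rightarrow> 'a set" where
  "antipodal_class v = {v, - v}"

definition antipodal_quotient :: "'a::uminus set set \<Rightarrow> 'a set set set" where
  "antipodal_quotient K = (\<lambda>\<sigma>. antipodal_class ` \<sigma>) ` K"

text \<open>Identifying antipodal vertices could collapse a face, or identify faces that are not
  antipodal to each other. The following says that neither happens, so that the faces of
  \<open>antipodal_quotient K\<close> are exactly the orbits of faces \<open>{\<sigma>, -\<sigma>}\<close>, with dimensions preserved.\<close>

definition antipodal_identification_proper :: "'a::uminus set set \<Rightarrow> bool" where
  "antipodal_identification_proper K \<longleftrightarrow>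
     (\<forall>\<sigma>\<in>K. inj_on antipodal_class \<sigma>) \<and>
     (\<forall>\<sigma>\<in>K. \<forall>\<tau>\<in>K. antipodal_class ` \<sigma> = antipodal_class ` \<tau> \<longleftrightarrow> \<tau> = \<sigma> \<or> \<tau> = uminus ` \<sigma>)"


section \<open>Real projective space\<close>

definition quotient_topology :: "'a topology \<Rightarrow> ('a \<Rightarrow> 'b) \<Rightarrow> 'b topology" where
  "quotient_topology X f =
     topology (\<lambda>U. U \<subseteq> f ` topspace X \<and> openin X {x \<in> topspace X. f x \<in> U})"

text \<open>Justifies the use of \<open>topology\<close> above.\<close>

lemma openin_quotient_topology:
  "openin (quotient_topology X f) U \<longleftrightarrow>
     U \<subseteq> f ` topspace X \<and> openin X {x \<in> topspace X. f x \<in> U}"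
proof -
  have "istopology (\<lambda>U. U \<subseteq> f ` topspace X \<and> openin X {x \<in> topspace X. f x \<in> U})"
    unfolding istopology_def
  proof (intro conjI allI impI)
    fix S T
    assume S: "S \<subseteq> f ` topspace X \<and> openin X {x \<in> topspace X. f x \<in> S}"
      and T: "T \<subseteq> f ` topspace X \<and> openin X {x \<in> topspace X. f x \<in> T}"
    have "{x \<in> topspace X. f x \<in> S \<inter> T}
        = {x \<in> topspace X. f x \<in> S} \<inter> {x \<in> topspace X. f x \<in> T}" by auto
    then show "openin X {x \<in> topspace X. f x \<in> S \<inter> T}" using S T by (simp add: openin_Int)
    show "S \<inter> T \<subseteq> f ` topspace X" using S by auto
  next
    fix \<K>
    assume K: "\<forall>K\<in>\<K>. K \<subseteq> f ` topspace X \<and> openin X {x \<in> topspace X. f x \<in> K}"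
    have "{x \<in> topspace X. f x \<in> \<Union>\<K>} = (\<Union>K\<in>\<K>. {x \<in> topspace X. f x \<in> K})" by auto
    then show "openin X {x \<in> topspace X. f x \<in> \<Union>\<K>}" using K by auto
    show "\<Union>\<K> \<subseteq> f ` topspace X" using K by auto
  qed
  then show ?thesis by (simp add: quotient_topology_def topology_inverse')
qed

text \<open>The unit sphere with antipodal points identified. For the point type \<open>real ^ 6\<close> this is
  the real projective space of dimension 5.\<close>

definition real_projective_space :: "'a::euclidean_space set topology" where
  "real_projective_space = quotient_topology (top_of_set (sphere 0 1)) antipodal_class"


section \<open>The polytope with 48 vertices in dimension 6\<close>

definition half_points_6_48 :: "(real ^ 6) list" where
  "half_points_6_48 =
    (let \<alpha> = 3/7; \<beta> = 4/7; \<gamma> = 5/7 in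
     [vector [0, \<gamma>, \<alpha>, \<beta>, 0, 0],
      vector [\<alpha>, 0, 0, -\<gamma>, -\<beta>, 0],
      vector [\<beta>, \<gamma>, -\<alpha>, 0, 0, 0],
      vector [-\<beta>, \<gamma>, -\<alpha>, 0, 0, 0],
      vector [-\<gamma>, 0, 0, -\<alpha>, -\<beta>, 0],
      vector [0, 0, \<beta>, 0, \<alpha>, -\<gamma>],
      vector [0, 0, \<beta>, 0, -\<gamma>, -\<alpha>],
      vector [-\<gamma>, 0, 0, -\<alpha>, \<beta>, 0],
      vector [0, \<beta>, 0, 0, -\<alpha>, -\<gamma>],
      vector [0, -\<gamma>, -\<alpha>, \<beta>, 0, 0],
      vector [0, -\<beta>, 0, 0, \<gamma>, -\<alpha>],
      vector [0, -\<beta>, 0, 0, -\<gamma>, \<alpha>],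
      vector [-\<gamma>, 0, 0, \<alpha>, 0, \<beta>],
      vector [-\<gamma>, 0, 0, \<alpha>, 0, -\<beta>],
      vector [0, 0, \<beta>, 0, -\<alpha>, \<gamma>],
      vector [\<alpha>, 0, 0, \<gamma>, 0, \<beta>],
      vector [0, \<alpha>, -\<gamma>, \<beta>, 0, 0],
      vector [\<alpha>, 0, 0, -\<gamma>, \<beta>, 0],
      vector [\<beta>, -\<alpha>, -\<gamma>, 0, 0, 0],
      vector [0, \<beta>, 0, 0, \<alpha>, \<gamma>],
      vector [0, 0, \<beta>, 0, \<gamma>, \<alpha>],
      vector [\<beta>, \<alpha>, \<gamma>, 0, 0, 0],
      vector [\<alpha>, 0, 0, \<gamma>, 0, -\<beta>],
      vector [0, \<alpha>, -\<gamma>, -\<beta>, 0, 0]])"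

definition points_6_48 :: "(real ^ 6) set" where
  "points_6_48 = set half_points_6_48 \<union> uminus ` set half_points_6_48"

definition polytope_6_48 :: "(real ^ 6) set" where
  "polytope_6_48 = convex hull points_6_48"

end

theory Submission
  imports Defs
begin

text \<open>A set \<open>N\<close> of candidate facet normals, each tight on exactly \<open>dim\<close> points of \<open>V\<close>, describes
  the whole boundary of the convex hull as soon as it is closed under pivoting, that is, under
  exchanging any single tight point. Indeed, choose \<open>n \<in> N\<close> maximal on a given \<open>x\<close> and expand \<open>x\<close>
  over the tight points of \<open>n\<close>: a negative coefficient at \<open>v\<close> would make the normal obtained by
  exchanging \<open>v\<close> larger on \<open>x\<close>. Hence the cones over the tight sets cover the space.

  The 1424 facets form twelve orbits under the signed permutations preserving the 48 points, so
  only twelve normals and their 72 pivots have to be checked, in integer arithmetic.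

  Two vertices on a common facet have positive inner product, so an edge \<open>{v, w}\<close> excludes the
  edge \<open>{v, -w}\<close>, and the antipodal identification is proper. The realization of the boundary
  complex then maps onto the realization of the quotient complex, and by radial projection onto
  the projective space. Both are quotient maps by compactness, and they have the same fibres.\<close>

section \<open>Facets certified by pivoting\<close>

text \<open>Each quotient map is constant on the fibres of the other, so each factors through the
  other, and the two induced maps are mutually inverse. This compares \<open>Y\<close> and
  \<open>Z\<close> through a common cover, with no direct map between them.\<close>

lemma homeomorphic_space_quotient_maps:
  assumes p: "quotient_map X Y p" and q: "quotient_map X Z q"
    and fibres: "\<And>x y. x \<in> topspace X \<Longrightarrow> y \<in> topspace X \<Longrightarrow> p x = p y \<longleftrightarrow> q x = q y"
  shows "Y homeomorphic_space Z"
proof -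
  obtain h where h: "continuous_map Y Z h" "\<And>x. x \<in> topspace X \<Longrightarrow> h (p x) = q x"
    using quotient_map_lift_exists [OF p quotient_imp_continuous_map [OF q]] fibres by metis
  obtain k where k: "continuous_map Z Y k" "\<And>x. x \<in> topspace X \<Longrightarrow> k (q x) = p x"
    using quotient_map_lift_exists [OF q quotient_imp_continuous_map [OF p]] fibres by metis
  have "topspace Y = p ` topspace X" "topspace Z = q ` topspace X"
    using quotient_imp_surjective_map p q by fast+
  then have "homeomorphic_maps Y Z h k"
    using h k by (auto simp: homeomorphic_maps_def)
  then show ?thesis
    by (auto simp: homeomorphic_space_def)
qed

lemma quotient_map_quotient_topology: "quotient_map X (quotient_topology X f) f"
proof -
  have "{x \<in> topspace X. f x \<in> f ` topspace X} = topspace X"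
    by auto
  then have "openin (quotient_topology X f) (f ` topspace X)"
    by (simp add: openin_quotient_topology)
  then have "topspace (quotient_topology X f) = f ` topspace X"
    using openin_quotient_topology [of X f "topspace (quotient_topology X f)"]
    by (simp add: openin_subset subset_antisym)
  then show ?thesis
    by (auto simp: quotient_map_def openin_quotient_topology)
qed

lemma antipodal_class_eq_iff:
  fixes v w :: "'a::group_add"
  shows "antipodal_class v = antipodal_class w \<longleftrightarrow> w = v \<or> w = - v"
  by (auto simp: antipodal_class_def doubleton_eq_iff)

lemma antipodal_class_uminus: "antipodal_class (- v) = antipodal_class (v :: 'a::group_add)"
  by (simp add: antipodal_class_eq_iff)

lemma antipodal_class_image_uminus:
  "antipodal_class ` uminus ` S = antipodal_class ` (S :: 'a::group_add set)"
  by (simp add: image_image antipodal_class_uminus)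

lemma support_uminus: "{v. b (- v) \<noteq> 0} = uminus ` {v :: 'a::group_add. b v \<noteq> 0}"
  by (force simp: image_iff)

text \<open>Normals are scaled so that every supporting hyperplane is at level 1. Independence of
  the tight sets, finiteness of \<open>N\<close> and the position of the origin in the interior are
  all consequences of \<open>pivot\<close>.\<close>

locale pivot_certificate =
  fixes V N :: "'a::euclidean_space set"
  assumes finite_V: "finite V"
    and N_nonempty: "N \<noteq> {}"
    and le_1: "n \<in> N \<Longrightarrow> v \<in> V \<Longrightarrow> n \<bullet> v \<le> 1"
    and card_facet: "n \<in> N \<Longrightarrow> card {v \<in> V. n \<bullet> v = 1} = DIM('a)"
    and pivot: "n \<in> N \<Longrightarrow> v \<in> V \<Longrightarrow> n \<bullet> v = 1 \<Longrightarrow>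
      \<exists>m\<in>N. m \<bullet> v \<noteq> 1 \<and> (\<forall>w\<in>V. n \<bullet> w = 1 \<and> w \<noteq> v \<longrightarrow> m \<bullet> w = 1)"
begin

section \<open>Independence of the tight sets and the cones that they span\<close>

definition facet :: "'a \<Rightarrow> 'a set" where
  "facet n = {v \<in> V. n \<bullet> v = 1}"

lemma finite_facet: "finite (facet n)"
  using finite_V by (simp add: facet_def)

lemma facet_pivot:
  assumes "n \<in> N" "v \<in> facet n"
  obtains m where "m \<in> N" "m \<bullet> v < 1" "\<And>w. w \<in> facet n \<Longrightarrow> w \<noteq> v \<Longrightarrow> m \<bullet> w = 1"
  using pivot [of n v] assms le_1 by (force simp: facet_def less_le)

text \<open>On the tight points of \<open>n\<close> the normals \<open>m\<close> and
  \<open>n\<close> agree except at \<open>v\<close>, so \<open>m - n\<close> annihilates every other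
  term. Up to the factor \<open>m \<bullet> v - 1\<close>, it is the coordinate functional of
  \<open>v\<close>.\<close>

lemma pivot_inner_sum:
  assumes "v \<in> facet n" "\<And>w. w \<in> facet n \<Longrightarrow> w \<noteq> v \<Longrightarrow> m \<bullet> w = 1"
  shows "(m - n) \<bullet> (\<Sum>w\<in>facet n. c w *\<^sub>R w) = c v * (m \<bullet> v - 1)"
proof -
  have "(m - n) \<bullet> (\<Sum>w\<in>facet n. c w *\<^sub>R w) = (\<Sum>w\<in>facet n. c w * (m \<bullet> w - 1))"
    by (auto simp: inner_sum_right inner_diff_left facet_def intro!: sum.cong)
  also have "\<dots> = (\<Sum>w\<in>facet n. if w = v then c v * (m \<bullet> v - 1) else 0)"
    using assms by (intro sum.cong) auto
  also have "\<dots> = c v * (m \<bullet> v - 1)"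
    using assms finite_facet by simp
  finally show ?thesis .
qed

text \<open>The differences between \<open>n\<close> and its pivots act as a dual system, each
  isolating one coefficient of a linear relation.\<close>

lemma independent_facet:
  assumes "n \<in> N"
  shows "independent (facet n)"
proof -
  have "c v = 0" if "(\<Sum>w\<in>facet n. c w *\<^sub>R w) = 0" "v \<in> facet n" for c v
  proof -
    obtain m where m: "m \<in> N" "m \<bullet> v < 1" "\<And>w. w \<in> facet n \<Longrightarrow> w \<noteq> v \<Longrightarrow> m \<bullet> w = 1"
      using facet_pivot assms \<open>v \<in> facet n\<close> by blast
    then show ?thesis
      using pivot_inner_sum [OF \<open>v \<in> facet n\<close> m(3), of c] that(1) by simp
  qed
  then show ?thesis
    by (auto simp: independent_explicit finite_facet)
qed

lemma affine_independent_facet: "n \<in> N \<Longrightarrow> \<not> affine_dependent (facet n)"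
  using independent_facet affine_dependent_imp_dependent by blast

lemma span_facet:
  assumes "n \<in> N"
  shows "span (facet n) = UNIV"
proof -
  have "card (facet n) = dim (UNIV :: 'a set)"
    using card_facet [OF assms] by (simp add: facet_def)
  then show ?thesis
    using card_eq_dim [OF subset_UNIV _ finite_facet] independent_facet [OF assms] by blast
qed

lemma facet_expansion:
  assumes "n \<in> N"
  obtains c where "x = (\<Sum>v\<in>facet n. c v *\<^sub>R v)"
proof -
  have "x \<in> range (\<lambda>c. \<Sum>v\<in>facet n. c v *\<^sub>R v)"
    using span_finite [OF finite_facet, of n] span_facet [OF assms] by simp
  then show thesis
    using that by blast
qed

lemma inner_facet_sum: "n \<bullet> (\<Sum>v\<in>facet n. c v *\<^sub>R v) = (\<Sum>v\<in>facet n. c v)"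
  by (auto simp: inner_sum_right facet_def intro!: sum.cong)

text \<open>A normal is determined by its tight set, because that set spans the space, and
  \<open>V\<close> has only finitely many subsets.\<close>

lemma finite_N: "finite N"
proof -
  have "inj_on facet N"
  proof
    fix n m assume nm: "n \<in> N" "m \<in> N" "facet n = facet m"
    \<comment> \<open>Both normals send this expansion to the sum of its coefficients, so
      \<open>n - m\<close> is orthogonal to itself.\<close>
    obtain c where c: "n - m = (\<Sum>v\<in>facet n. c v *\<^sub>R v)"
      using facet_expansion nm by blast
    have "n \<bullet> (n - m) = m \<bullet> (n - m)"
      using inner_facet_sum [of n c] inner_facet_sum [of m c] nm(3) c by simp
    then show "n = m"
      by (metis inner_diff_left inner_eq_zero_iff right_minus_eq)
  qed
  moreover have "facet ` N \<subseteq> Pow V"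
    by (auto simp: facet_def)
  ultimately show ?thesis
    using finite_V by (meson finite_Pow_iff finite_imageD finite_subset)
qed

text \<open>Maximality of \<open>n\<close> on \<open>x\<close> is kept among the conclusions:
  together with \<open>facet_inner_pos\<close> it shows that \<open>n \<bullet> x\<close> is
  positive for nonzero \<open>x\<close>, which allows \<open>x\<close> to be rescaled onto the
  facet.\<close>

lemma in_facet_cone:
  obtains n c where "n \<in> N" "\<And>v. v \<in> facet n \<Longrightarrow> 0 \<le> c v" "x = (\<Sum>v\<in>facet n. c v *\<^sub>R v)"
    "n \<bullet> x = (\<Sum>v\<in>facet n. c v)" "\<And>m. m \<in> N \<Longrightarrow> m \<bullet> x \<le> n \<bullet> x"
proof -
  have "Max ((\<lambda>n. n \<bullet> x) ` N) \<in> (\<lambda>n. n \<bullet> x) ` N"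
    using finite_N N_nonempty by (intro Max_in) auto
  then obtain n where n: "n \<in> N" "n \<bullet> x = Max ((\<lambda>n. n \<bullet> x) ` N)"
    by force
  have max: "m \<bullet> x \<le> n \<bullet> x" if "m \<in> N" for m
    unfolding n(2) using that finite_N by simp
  obtain c where c: "x = (\<Sum>v\<in>facet n. c v *\<^sub>R v)"
    using facet_expansion n(1) by blast
  have "0 \<le> c v" if v: "v \<in> facet n" for v
  proof -
    obtain m where m: "m \<in> N" "m \<bullet> v < 1" "\<And>w. w \<in> facet n \<Longrightarrow> w \<noteq> v \<Longrightarrow> m \<bullet> w = 1"
      using facet_pivot n(1) v by blast
    have "c v * (m \<bullet> v - 1) = (m - n) \<bullet> x"
      using pivot_inner_sum [OF v m(3), of c] c by simp
    also have "\<dots> \<le> 0"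
      using max [OF m(1)] by (simp add: inner_diff_left)
    finally show ?thesis
      using m(2) by (simp add: mult_le_0_iff)
  qed
  moreover have "n \<bullet> x = (\<Sum>v\<in>facet n. c v)"
    using inner_facet_sum c by simp
  ultimately show thesis
    using that n(1) c max by blast
qed

text \<open>On a cone expansion of \<open>x\<close> the chosen normal is the sum of nonnegative
  coefficients, and this sum vanishes only when all of them do.\<close>

lemma facet_inner_pos:
  assumes "x \<noteq> 0"
  obtains n where "n \<in> N" "0 < n \<bullet> x"
proof -
  obtain n c where c: "n \<in> N" "\<And>v. v \<in> facet n \<Longrightarrow> 0 \<le> c v" "x = (\<Sum>v\<in>facet n. c v *\<^sub>R v)"
    "n \<bullet> x = (\<Sum>v\<in>facet n. c v)"
    by (rule in_facet_cone [of x]) blast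
  have "(\<Sum>v\<in>facet n. c v) \<noteq> 0"
  proof
    assume "(\<Sum>v\<in>facet n. c v) = 0"
    then have "\<forall>v\<in>facet n. c v = 0"
      using c(2) finite_facet by (simp add: sum_nonneg_eq_0_iff)
    then show False
      using assms c(3) by simp
  qed
  then have "0 < n \<bullet> x"
    using c(2,4) by (metis order_le_less sum_nonneg)
  then show thesis
    using that c(1) by blast
qed

section \<open>The hull as an intersection of half-spaces\<close>

lemma hull_inner_le:
  assumes "n \<in> N" "x \<in> convex hull V"
  shows "n \<bullet> x \<le> 1"
proof -
  have "convex hull V \<subseteq> {x. n \<bullet> x \<le> 1}"
    using le_1 [OF assms(1)] by (intro hull_minimal) (auto simp: convex_halfspace_le)
  then show ?thesis
    using assms(2) by auto
qed

lemma facet_combination: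
  assumes "\<And>v. v \<in> facet n \<Longrightarrow> 0 \<le> c v" "(\<Sum>v\<in>facet n. c v) = 1"
  shows "(\<Sum>v\<in>facet n. c v *\<^sub>R v) \<in> convex hull facet n"
  unfolding convex_hull_finite [OF finite_facet]
  using assms by (intro CollectI exI [of _ c]) simp

lemma facet_hull_subset: "convex hull facet n \<subseteq> convex hull V"
  by (intro hull_mono) (auto simp: facet_def)

text \<open>Expanding the negative of the sum of all points in a facet cone and adding that sum back
  gives a linear relation on \<open>V\<close> with strictly positive coefficients. Normalising it
  exhibits the origin.\<close>

lemma zero_in_hull: "0 \<in> convex hull V"
proof -
  define s where "s = (\<Sum>v\<in>V. v)"
  obtain n where n: "n \<in> N"
    using N_nonempty by blast
  have "V \<noteq> {}"
    using card_facet [OF n] by fastforce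
  obtain m c where c: "m \<in> N" "\<And>v. v \<in> facet m \<Longrightarrow> 0 \<le> c v" "- s = (\<Sum>v\<in>facet m. c v *\<^sub>R v)"
    by (rule in_facet_cone [of "- s"]) blast
  \<comment> \<open>The 1 comes from \<open>s\<close>, the other term from the cone expansion of
    \<open>- s\<close>; the 1 makes all coefficients positive.\<close>
  define d where "d v = 1 + (if v \<in> facet m then c v else 0)" for v
  have "(\<Sum>v\<in>V. d v *\<^sub>R v) = s + (\<Sum>v\<in>V. if v \<in> facet m then c v *\<^sub>R v else 0)"
    unfolding d_def s_def by (auto simp: scaleR_add_left sum.distrib intro!: sum.cong)
  also have "\<dots> = s + (\<Sum>v\<in>facet m. c v *\<^sub>R v)"
    using finite_V by (simp add: sum.inter_filter facet_def)
  finally have 0: "(\<Sum>v\<in>V. d v *\<^sub>R v) = 0"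
    using c(3) by (metis add.right_inverse)
  have d: "0 < d v" for v
    using c(2) by (auto simp: d_def add_pos_nonneg)
  define D where "D = (\<Sum>v\<in>V. d v)"
  have D: "0 < D"
    unfolding D_def using finite_V \<open>V \<noteq> {}\<close> d by (intro sum_pos) auto
  have "(\<Sum>v\<in>V. (d v / D) *\<^sub>R v) = (1 / D) *\<^sub>R (\<Sum>v\<in>V. d v *\<^sub>R v)"
    by (simp add: scaleR_sum_right)
  then have "(\<Sum>v\<in>V. (d v / D) *\<^sub>R v) = 0"
    using 0 by simp
  moreover have "(\<Sum>v\<in>V. d v / D) = 1"
    using D by (simp add: D_def sum_divide_distrib [symmetric])
  moreover have "\<forall>v\<in>V. 0 \<le> d v / D"
    using d D by (simp add: less_imp_le)
  ultimately show ?thesis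
    unfolding convex_hull_finite [OF finite_V] by (intro CollectI exI [of _ "\<lambda>v. d v / D"]) simp
qed

lemma hull_eq: "convex hull V = {x. \<forall>n\<in>N. n \<bullet> x \<le> 1}"
proof
  show "convex hull V \<subseteq> {x. \<forall>n\<in>N. n \<bullet> x \<le> 1}"
    using hull_inner_le by auto
  show "{x. \<forall>n\<in>N. n \<bullet> x \<le> 1} \<subseteq> convex hull V"
  proof clarify
    fix x assume x: "\<forall>n\<in>N. n \<bullet> x \<le> 1"
    show "x \<in> convex hull V"
    proof (cases "x = 0")
      case True
      then show ?thesis
        using zero_in_hull by simp
    next
      case False
      obtain n c where c: "n \<in> N" "\<And>v. v \<in> facet n \<Longrightarrow> 0 \<le> c v" "x = (\<Sum>v\<in>facet n. c v *\<^sub>R v)"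
        "n \<bullet> x = (\<Sum>v\<in>facet n. c v)" "\<And>m. m \<in> N \<Longrightarrow> m \<bullet> x \<le> n \<bullet> x"
        by (rule in_facet_cone [of x]) blast
      define t where "t = n \<bullet> x"
      obtain m where "m \<in> N" "0 < m \<bullet> x"
        using facet_inner_pos [OF False] by blast
      then have t: "0 < t" "t \<le> 1"
        using c(1) c(5) [of m] x by (auto simp: t_def)
      \<comment> \<open>Dividing by \<open>t\<close> moves \<open>x\<close> radially onto the facet
        of \<open>n\<close>.\<close>
      have "(1 / t) *\<^sub>R x = (\<Sum>v\<in>facet n. (c v / t) *\<^sub>R v)"
        unfolding c(3) by (simp add: scaleR_sum_right)
      moreover have "(\<Sum>v\<in>facet n. c v / t) = 1"
        using c(4) t(1) by (simp add: t_def sum_divide_distrib [symmetric])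
      ultimately have "(1 / t) *\<^sub>R x \<in> convex hull facet n"
        using facet_combination [of n "\<lambda>v. c v / t"] c(2) t(1) by simp
      then have "(1 / t) *\<^sub>R x \<in> convex hull V"
        using facet_hull_subset by blast
      \<comment> \<open>Since \<open>t \<le> 1\<close>, the point \<open>x\<close> lies on the
        segment from the origin to its radial projection.\<close>
      then have "(1 - t) *\<^sub>R 0 + t *\<^sub>R ((1 / t) *\<^sub>R x) \<in> convex hull V"
        using t zero_in_hull by (intro convexD convex_convex_hull) auto
      then show ?thesis
        using t by simp
    qed
  qed
qed

section \<open>Interior, facets and proper faces of the hull\<close>

lemma in_interior_hull:
  assumes "\<And>n. n \<in> N \<Longrightarrow> n \<bullet> x < 1"
  shows "x \<in> interior (convex hull V)"
proof (rule interiorI)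
  show "open (\<Inter>n\<in>N. {x. n \<bullet> x < 1})"
    using finite_N by (intro open_INT) (auto simp: open_halfspace_lt)
  show "x \<in> (\<Inter>n\<in>N. {x. n \<bullet> x < 1})"
    using assms by simp
  show "(\<Inter>n\<in>N. {x. n \<bullet> x < 1}) \<subseteq> convex hull V"
    unfolding hull_eq by force
qed

lemma zero_in_interior: "0 \<in> interior (convex hull V)"
  by (rule in_interior_hull) simp

lemma aff_dim_hull: "aff_dim (convex hull V) = DIM('a)"
  using zero_in_interior by (intro aff_dim_nonempty_interior) auto

text \<open>The hyperplane section is a face, hence the hull of some of the points of
  \<open>V\<close>. Those points lie on the hyperplane, so they are tight.\<close>

lemma facet_hull: "n \<in> N \<Longrightarrow> convex hull V \<inter> {x. n \<bullet> x = 1} = convex hull facet n"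
proof
  assume n: "n \<in> N"
  have "convex hull V \<inter> {x. n \<bullet> x = 1} face_of convex hull V"
    using n hull_inner_le by (intro face_of_Int_supporting_hyperplane_le) auto
  then obtain S where S: "S \<subseteq> V" "convex hull V \<inter> {x. n \<bullet> x = 1} = convex hull S"
    using face_of_convex_hull_subset finite_imp_compact [OF finite_V] by metis
  then have "S \<subseteq> facet n"
    using hull_subset [of S convex] by (auto simp: facet_def)
  then show "convex hull V \<inter> {x. n \<bullet> x = 1} \<subseteq> convex hull facet n"
    using S(2) hull_mono by metis
  have "facet n \<subseteq> convex hull V \<inter> {x. n \<bullet> x = 1}"
    using hull_subset [of V convex] by (auto simp: facet_def)
  then show "convex hull facet n \<subseteq> convex hull V \<inter> {x. n \<bullet> x = 1}"
    by (intro hull_minimal convex_Int convex_convex_hull convex_hyperplane)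
qed

lemma facet_face: "n \<in> N \<Longrightarrow> convex hull facet n face_of convex hull V"
  using facet_hull [of n] hull_inner_le
    face_of_Int_supporting_hyperplane_le [of "convex hull V" n 1] by simp

text \<open>A nonempty proper face has a relative interior point on some facet and is therefore
  contained in that facet. The facet is a simplex, whose faces are exactly the hulls of sets of its
  vertices.\<close>

lemma proper_face_iff:
  "F face_of convex hull V \<and> F \<noteq> convex hull V \<longleftrightarrow> (\<exists>n\<in>N. \<exists>T\<subseteq>facet n. F = convex hull T)"
proof
  assume F: "F face_of convex hull V \<and> F \<noteq> convex hull V"
  have "\<exists>n\<in>N. F \<subseteq> convex hull facet n"
  proof (cases "F = {}")
    case True
    then show ?thesis
      using N_nonempty by auto
  next
    case False
    have "convex F"
      using F face_of_imp_convex by blast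
    then obtain x where x: "x \<in> rel_interior F"
      using False rel_interior_eq_empty by blast
    then have "x \<in> F"
      using rel_interior_subset by blast
    then have xV: "x \<in> convex hull V"
      using F face_of_imp_subset by blast
    \<comment> \<open>A proper face misses the interior, so one of the inequalities must be an
      equality at \<open>x\<close>.\<close>
    have "x \<notin> interior (convex hull V)"
      using face_of_disjoint_interior [of F "convex hull V"] F \<open>x \<in> F\<close> by blast
    then obtain n where n: "n \<in> N" "n \<bullet> x = 1"
      using in_interior_hull [of x] hull_inner_le xV by (metis order_le_less)
    then have "x \<in> convex hull facet n"
      using facet_hull xV by blast
    then have "F \<subseteq> convex hull facet n"
      using subset_of_face_of [OF facet_face [OF n(1)], of F] F x face_of_imp_subset by blast
    then show ?thesis
      using n(1) by blast
  qed
  then obtain n where n: "n \<in> N" "F \<subseteq> convex hull facet n"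
    by blast
  then have "F face_of convex hull facet n"
    using F facet_face face_of_subset face_of_imp_subset by blast
  then show "\<exists>n\<in>N. \<exists>T\<subseteq>facet n. F = convex hull T"
    using n(1) face_of_convex_hull_subset finite_imp_compact [OF finite_facet] by metis
next
  assume "\<exists>n\<in>N. \<exists>T\<subseteq>facet n. F = convex hull T"
  then obtain n T where T: "n \<in> N" "T \<subseteq> facet n" "F = convex hull T"
    by blast
  then have "F face_of convex hull facet n"
    using face_of_convex_hull_affine_independent affine_independent_facet by blast
  moreover have "F \<noteq> convex hull V"
  proof
    assume "F = convex hull V"
    then have "0 \<in> convex hull facet n"
      using zero_in_hull T(2,3) hull_mono by blast
    then show False
      using facet_hull [OF T(1)] by force
  qed
  ultimately show "F face_of convex hull V \<and> F \<noteq> convex hull V"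
    using face_of_trans facet_face T(1) by blast
qed

text \<open>Affine independence makes each point of \<open>T\<close> extreme in the hull of
  \<open>T\<close>, so a face and its vertex set determine each other.\<close>

lemma boundary_complex_hull: "boundary_complex (convex hull V) = {T. \<exists>n\<in>N. T \<subseteq> facet n}"
proof -
  have ext: "{v. v extreme_point_of convex hull T} = T" if "n \<in> N" "T \<subseteq> facet n" for n T
    using extreme_point_of_convex_hull_affine_independent affine_independent_facet
      affine_independent_subset that by blast
  show ?thesis
  proof
    show "boundary_complex (convex hull V) \<subseteq> {T. \<exists>n\<in>N. T \<subseteq> facet n}"
    proof
      fix S assume "S \<in> boundary_complex (convex hull V)"
      then obtain F where "S = {v. v extreme_point_of F}" "F face_of convex hull V" "F \<noteq> convex hull V"
        unfolding boundary_complex_def by blast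
      then show "S \<in> {T. \<exists>n\<in>N. T \<subseteq> facet n}"
        using ext proper_face_iff [of F] by auto
    qed
    show "{T. \<exists>n\<in>N. T \<subseteq> facet n} \<subseteq> boundary_complex (convex hull V)"
    proof clarify
      fix T n assume "n \<in> N" "T \<subseteq> facet n"
      then show "T \<in> boundary_complex (convex hull V)"
        unfolding boundary_complex_def using ext [of n T] proper_face_iff [of "convex hull T"] by blast
    qed
  qed
qed

lemma simplicial_polytope_hull: "simplicial_polytope (convex hull V)"
  unfolding simplicial_polytope_def
proof (intro conjI allI impI)
  show "polytope (convex hull V)"
    using finite_V by (auto simp: polytope_def)
  fix F assume "F face_of convex hull V \<and> F \<noteq> convex hull V"
  then obtain n T where T: "n \<in> N" "T \<subseteq> facet n" "F = convex hull T"
    using proper_face_iff by blast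
  then have "\<not> affine_dependent T"
    using affine_independent_facet affine_independent_subset by blast
  \<comment> \<open>For empty \<open>T\<close> the dimension is -1, which accounts for the empty
    face.\<close>
  then have "(int (card T) - 1) simplex F"
    using T(3) by (auto simp: simplex_def)
  then show "\<exists>n. n simplex F" ..
qed

end

section \<open>The antipodal quotient of the boundary complex\<close>

lemma continuous_on_coordinate: "continuous_on A (\<lambda>b. b v)"
  by (rule continuous_on_subset [OF continuous_on_product_coordinates subset_UNIV])

text \<open>The common norm \<open>r\<close> guarantees that no point of \<open>V\<close> is lost as
  a vertex. \<open>acute\<close> keeps antipodal points, and antipodal choices of the second end of
  an edge, out of the same face complex.\<close>

locale antipodal_certificate = pivot_certificate +
  fixes r :: real
  assumes uminus_V: "v \<in> V \<Longrightarrow> - v \<in> V"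
    and uminus_N: "n \<in> N \<Longrightarrow> - n \<in> N"
    and norm_V: "v \<in> V \<Longrightarrow> norm v = r"
    and acute: "n \<in> N \<Longrightarrow> v \<in> V \<Longrightarrow> n \<bullet> v = 1 \<Longrightarrow> w \<in> V \<Longrightarrow> n \<bullet> w = 1 \<Longrightarrow> 0 < v \<bullet> w"
begin

lemma centrally_symmetric_hull: "centrally_symmetric (convex hull V)"
proof -
  have "uminus ` V = V"
    using uminus_V by force
  moreover have "uminus ` (convex hull V) = convex hull (uminus ` V)"
    by (intro convex_hull_linear_image linear_uminus)
  ultimately show ?thesis
    by (simp add: centrally_symmetric_def)
qed

section \<open>Faces under the antipodal map\<close>

definition faces :: "'a set set" where
  "faces = {T. \<exists>n\<in>N. T \<subseteq> facet n}"

lemma face_subset: "T \<in> faces \<Longrightarrow> T \<subseteq> V"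
  by (auto simp: faces_def facet_def)

lemma finite_face: "T \<in> faces \<Longrightarrow> finite T"
  using face_subset finite_V finite_subset by blast

lemma finite_faces: "finite faces"
  using face_subset finite_V by (meson Pow_iff finite_Pow_iff finite_subset subsetI)

lemma subset_face: "T \<in> faces \<Longrightarrow> S \<subseteq> T \<Longrightarrow> S \<in> faces"
  by (auto simp: faces_def)

lemma uminus_face:
  assumes "T \<in> faces"
  shows "uminus ` T \<in> faces"
proof -
  obtain n where n: "n \<in> N" "T \<subseteq> facet n"
    using assms by (auto simp: faces_def)
  have "uminus ` T \<subseteq> facet (- n)"
    using n(2) uminus_V by (auto simp: facet_def)
  then show ?thesis
    using uminus_N [OF n(1)] by (auto simp: faces_def)
qed

lemma face_acute:
  assumes "T \<in> faces" "v \<in> T" "w \<in> T"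
  shows "0 < v \<bullet> w"
proof -
  obtain n where "n \<in> N" "T \<subseteq> facet n"
    using assms(1) by (auto simp: faces_def)
  then show ?thesis
    using acute [of n v w] assms(2,3) by (auto simp: facet_def)
qed

lemma uminus_notin_face: "T \<in> faces \<Longrightarrow> v \<in> T \<Longrightarrow> - v \<notin> T"
  by (metis face_acute inner_minus_right less_asym neg_0_less_iff_less)

lemma inj_on_face: "T \<in> faces \<Longrightarrow> inj_on antipodal_class T"
  using uminus_notin_face by (auto simp: inj_on_def antipodal_class_eq_iff)

text \<open>The shared vertex \<open>v\<close> fixes all signs: if \<open>w\<close> is in
  \<open>S\<close> and \<open>- w\<close> is in \<open>T\<close>, then \<open>v\<close> would have
  positive inner product with both.\<close>

lemma face_subset_face:
  assumes S: "S \<in> faces" and T: "T \<in> faces" and eq: "antipodal_class ` S = antipodal_class ` T"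
    and v: "v \<in> S" "v \<in> T"
  shows "S \<subseteq> T"
proof
  fix w assume w: "w \<in> S"
  then obtain u where u: "u \<in> T" "antipodal_class w = antipodal_class u"
    using eq by (metis imageE imageI)
  then have "u = w \<or> u = - w"
    by (simp add: antipodal_class_eq_iff)
  moreover have "u \<noteq> - w"
    using face_acute [OF S v(1) w] face_acute [OF T v(2) u(1)] by auto
  ultimately show "w \<in> T"
    using u(1) by auto
qed

text \<open>A vertex of \<open>S\<close> occurs in \<open>T\<close> up to sign. Replacing
  \<open>S\<close> by its antipode if necessary, the two faces share a vertex, and
  \<open>face_subset_face\<close> applies in both directions.\<close>

lemma face_class_cases:
  assumes S: "S \<in> faces" and T: "T \<in> faces" and eq: "antipodal_class ` S = antipodal_class ` T"
  shows "T = S \<or> T = uminus ` S"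
proof (cases "S = {}")
  case True
  then show ?thesis
    using eq by auto
next
  case False
  then obtain v where v: "v \<in> S"
    by blast
  then obtain u where u: "u \<in> T" "antipodal_class v = antipodal_class u"
    using eq by (metis imageE imageI)
  have S': "uminus ` S \<in> faces" "antipodal_class ` uminus ` S = antipodal_class ` T"
    using uminus_face [OF S] eq by (simp_all add: antipodal_class_image_uminus)
  consider "u = v" | "u = - v"
    using u(2) by (auto simp: antipodal_class_eq_iff)
  then show ?thesis
  proof cases
    case 1
    then have "v \<in> T"
      using u(1) by simp
    then have "S \<subseteq> T" "T \<subseteq> S"
      using face_subset_face [OF S T eq v] face_subset_face [OF T S eq [symmetric] _ v] by auto
    then show ?thesis
      by simp
  next
    case 2
    then have "u \<in> uminus ` S"
      using v by blast
    then have "uminus ` S \<subseteq> T" "T \<subseteq> uminus ` S"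
      using face_subset_face [OF S'(1) T S'(2) _ u(1)]
        face_subset_face [OF T S'(1) S'(2) [symmetric] u(1)] by auto
    then show ?thesis
      by simp
  qed
qed

lemma boundary_complex_eq: "boundary_complex (convex hull V) = faces"
  by (simp add: boundary_complex_hull faces_def)

lemma antipodal_identification_proper_hull:
  "antipodal_identification_proper (boundary_complex (convex hull V))"
  unfolding antipodal_identification_proper_def boundary_complex_eq
proof (intro conjI ballI)
  fix S T assume ST: "S \<in> faces" "T \<in> faces"
  show "antipodal_class ` S = antipodal_class ` T \<longleftrightarrow> T = S \<or> T = uminus ` S"
  proof
    assume "T = S \<or> T = uminus ` S"
    then show "antipodal_class ` S = antipodal_class ` T"
      by (elim disjE) (simp_all only: antipodal_class_image_uminus)
  qed (rule face_class_cases [OF ST])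
qed (rule inj_on_face)

text \<open>All points of \<open>V\<close> lie on a sphere, so none of them is a convex combination of
  the origin and other points of \<open>V\<close>.\<close>

lemma in_facet:
  assumes v: "v \<in> V"
  obtains n where "n \<in> N" "v \<in> facet n"
proof -
  obtain n c where c: "n \<in> N" "\<And>w. w \<in> facet n \<Longrightarrow> 0 \<le> c w" "v = (\<Sum>w\<in>facet n. c w *\<^sub>R w)"
    "n \<bullet> v = (\<Sum>w\<in>facet n. c w)"
    by (rule in_facet_cone [of v]) blast
  have le: "w \<bullet> v \<le> v \<bullet> v" if "w \<in> V" for w
    using norm_cauchy_schwarz [of w v] norm_V [OF that] norm_V [OF v]
    by (simp add: dot_square_norm power2_eq_square)
  have "v \<bullet> v = (\<Sum>w\<in>facet n. c w * (w \<bullet> v))"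
    by (subst (1) c(3)) (simp add: inner_sum_left)
  also have "\<dots> \<le> (\<Sum>w\<in>facet n. c w * (v \<bullet> v))"
    using c(2) le by (intro sum_mono mult_left_mono) (auto simp: facet_def)
  also have "\<dots> = (n \<bullet> v) * (v \<bullet> v)"
    unfolding c(4) by (simp add: sum_distrib_right)
  finally have "v \<bullet> v \<le> (n \<bullet> v) * (v \<bullet> v)" .
  \<comment> \<open>Needed to cancel \<open>v \<bullet> v\<close>. If \<open>v\<close> were 0, the
    radius would be 0 and no point of \<open>V\<close> could be tight, although each facet has a
    positive number of tight points.\<close>
  moreover have "v \<noteq> 0"
  proof
    assume "v = 0"
    then have "r = 0"
      using norm_V [OF v] by simp
    then have "V \<subseteq> {0}"
      using norm_V by auto
    then have "facet n = {}"
      by (auto simp: facet_def)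
    moreover have "card (facet n) = DIM('a)"
      using card_facet [OF c(1)] by (simp add: facet_def)
    ultimately show False
      by simp
  qed
  ultimately have "1 \<le> n \<bullet> v"
    by simp
  then show thesis
    using that [OF c(1)] le_1 [OF c(1) v] v by (simp add: facet_def)
qed

lemma complex_vertices_antipodal_quotient:
  "complex_vertices (antipodal_quotient (boundary_complex (convex hull V))) = antipodal_class ` V"
proof -
  have "\<Union>faces = V"
  proof
    show "V \<subseteq> \<Union>faces"
      using in_facet by (auto simp: faces_def) (metis subset_refl)
  qed (use face_subset in auto)
  then show ?thesis
    unfolding complex_vertices_def antipodal_quotient_def boundary_complex_eq by blast
qed

section \<open>The realization of the boundary complex and its radial projection\<close>

definition realization :: "('a \<Rightarrow> real) set" where
  "realization = {b. (\<forall>v. 0 \<le> b v) \<and> {v. b v \<noteq> 0} \<in> faces \<and> sum b V = 1}"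

definition combination :: "('a \<Rightarrow> real) \<Rightarrow> 'a" where
  "combination b = (\<Sum>v\<in>V. b v *\<^sub>R v)"

lemma realization_nonneg: "b \<in> realization \<Longrightarrow> 0 \<le> b v"
  by (simp add: realization_def)

lemma realization_support: "b \<in> realization \<Longrightarrow> {v. b v \<noteq> 0} \<in> faces"
  by (simp add: realization_def)

lemma realization_sum: "b \<in> realization \<Longrightarrow> sum b V = 1"
  by (simp add: realization_def)

text \<open>Reconciles the sum over the support used for geometric realizations with the sum over
  the fixed finite set \<open>V\<close> used in \<open>realization\<close>. The latter is visibly
  continuous in the coordinates.\<close>

lemma sum_support:
  assumes "{v. b v \<noteq> 0} \<in> faces"
  shows "(\<Sum>v | b v \<noteq> 0. b v) = sum b V"
  using face_subset [OF assms] finite_V by (intro sum.mono_neutral_left) auto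

text \<open>One closed simplex for each facet. Unlike the condition that the support is a face,
  vanishing off a fixed facet is a closed condition on each coordinate.\<close>

lemma realization_eq:
  "realization = (\<Union>n\<in>N. {b. (\<forall>v. 0 \<le> b v) \<and> (\<forall>v. v \<notin> facet n \<longrightarrow> b v = 0) \<and> sum b V = 1})"
  by (auto simp: realization_def faces_def)

lemma compact_realization: "compact realization"
proof -
  \<comment> \<open>Tychonoff: there is one coordinate for every point of the space, not only for
    the points of \<open>V\<close>.\<close>
  have "compact (PiE UNIV (\<lambda>v :: 'a. {0..1 :: real}))"
    unfolding compactin_euclidean_iff [symmetric] euclidean_product_topology [symmetric]
      compactin_PiE
    by simp
  moreover have "closed realization"
    unfolding realization_eq
  proof (intro closed_UN finite_N ballI)
    fix n
    have "closed {b :: 'a \<Rightarrow> real. 0 \<le> b v}" for v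
      by (intro closed_Collect_le continuous_on_const continuous_on_coordinate)
    moreover have "closed {b :: 'a \<Rightarrow> real. b v = 0}" for v
      by (intro closed_Collect_eq continuous_on_const continuous_on_coordinate)
    then have "closed {b :: 'a \<Rightarrow> real. v \<notin> facet n \<longrightarrow> b v = 0}" for v
      by (cases "v \<in> facet n") simp_all
    moreover have "closed {b :: 'a \<Rightarrow> real. sum b V = 1}"
      by (intro closed_Collect_eq continuous_intros continuous_on_coordinate)
    ultimately show "closed {b. (\<forall>v. 0 \<le> b v) \<and> (\<forall>v. v \<notin> facet n \<longrightarrow> b v = 0) \<and> sum b V = (1 :: real)}"
      by (intro closed_Collect_conj closed_Collect_all)
  qed
  moreover have "realization \<subseteq> PiE UNIV (\<lambda>v. {0..1})"
  proof clarify
    fix b assume b: "b \<in> realization"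
    have "b v \<le> 1" for v
    proof (cases "b v = 0")
      case False
      then have "v \<in> V"
        using face_subset [OF realization_support [OF b]] by auto
      then have "b v \<le> sum b V"
        using finite_V realization_nonneg [OF b] by (intro member_le_sum) auto
      then show ?thesis
        using realization_sum [OF b] by simp
    qed auto
    then show "b \<in> PiE UNIV (\<lambda>v. {0..1})"
      using realization_nonneg [OF b] by auto
  qed
  ultimately show ?thesis
    by (metis compact_Int_closed inf.absorb2)
qed

lemma continuous_on_combination: "continuous_on A combination"
  unfolding combination_def by (intro continuous_intros continuous_on_coordinate)

lemma inner_combination: "m \<bullet> combination b = (\<Sum>v\<in>V. b v * (m \<bullet> v))"
  by (simp add: combination_def inner_sum_right)

lemma inner_combination_le:
  assumes "b \<in> realization" "m \<in> N"
  shows "m \<bullet> combination b \<le> 1"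
proof -
  have "m \<bullet> combination b \<le> (\<Sum>v\<in>V. b v * 1)"
    unfolding inner_combination
    using assms le_1 by (intro sum_mono mult_left_mono realization_nonneg) auto
  then show ?thesis
    using realization_sum [OF assms(1)] by simp
qed

text \<open>The slack of \<open>combination b\<close> is the nonnegative combination of the slacks
  of the points of \<open>V\<close>, so it vanishes exactly when every point of nonzero weight is
  tight.\<close>

lemma inner_combination_eq_iff:
  assumes b: "b \<in> realization" and m: "m \<in> N"
  shows "m \<bullet> combination b = 1 \<longleftrightarrow> {v. b v \<noteq> 0} \<subseteq> facet m"
proof -
  have "1 - m \<bullet> combination b = (\<Sum>v\<in>V. b v * (1 - m \<bullet> v))"
    using realization_sum [OF b] by (simp add: inner_combination algebra_simps sum_subtractf)
  moreover have "(\<Sum>v\<in>V. b v * (1 - m \<bullet> v)) = 0 \<longleftrightarrow> (\<forall>v\<in>V. b v * (1 - m \<bullet> v) = 0)"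
    using finite_V le_1 [OF m] realization_nonneg [OF b] by (intro sum_nonneg_eq_0_iff) auto
  moreover have "\<dots> \<longleftrightarrow> {v. b v \<noteq> 0} \<subseteq> facet m"
    using face_subset [OF realization_support [OF b]] by (auto simp: facet_def)
  ultimately show ?thesis
    by linarith
qed

lemma combination_facet:
  assumes "b \<in> realization"
  obtains n where "n \<in> N" "n \<bullet> combination b = 1" "{v. b v \<noteq> 0} \<subseteq> facet n"
  using realization_support [OF assms] inner_combination_eq_iff [OF assms]
  by (auto simp: faces_def)

text \<open>A normal that is tight at the common image forces both supports into a single facet,
  where linear independence makes the coordinates unique.\<close>

lemma inj_on_combination: "inj_on combination realization"
proof
  fix b c assume b: "b \<in> realization" and c: "c \<in> realization" and eq: "combination b = combination c"
  obtain n where n: "n \<in> N" "n \<bullet> combination b = 1" "{v. b v \<noteq> 0} \<subseteq> facet n"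
    using combination_facet [OF b] .
  then have supp: "{v. c v \<noteq> 0} \<subseteq> facet n"
    using inner_combination_eq_iff [OF c] eq by simp
  have zero: "b v = 0" "c v = 0" if "v \<notin> facet n" for v
    using n(3) supp that by auto
  have "facet n \<subseteq> V"
    by (auto simp: facet_def)
  then have "(\<Sum>v\<in>facet n. (b v - c v) *\<^sub>R v) = (\<Sum>v\<in>V. (b v - c v) *\<^sub>R v)"
    using finite_V zero by (intro sum.mono_neutral_left) simp_all
  also have "\<dots> = 0"
    using eq by (simp add: combination_def scaleR_diff_left sum_subtractf)
  finally have "\<forall>v\<in>facet n. b v - c v = 0"
    using independent_facet [OF n(1)] unfolding independent_explicit by meson
  then show "b = c"
    using zero by (intro ext) (metis right_minus_eq)
qed

lemma combination_nonzero: "b \<in> realization \<Longrightarrow> combination b \<noteq> 0"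
  by (erule combination_facet) auto

text \<open>The images lie on the boundary of the hull, and scaling by more than 1 would violate the
  inequality that is tight at \<open>combination b\<close>. Used in both directions, this says that
  a ray from the origin meets the boundary only once.\<close>

lemma combination_scaled:
  assumes b: "b \<in> realization" and c: "c \<in> realization" and t: "0 < t"
    and eq: "combination c = t *\<^sub>R combination b"
  shows "t \<le> 1"
proof -
  obtain n where n: "n \<in> N" "n \<bullet> combination b = 1"
    using combination_facet [OF b] by blast
  then show ?thesis
    using inner_combination_le [OF c n(1)] eq by simp
qed

lemma inj_on_sgn_combination: "inj_on (\<lambda>b. sgn (combination b)) realization"
proof
  fix b c assume b: "b \<in> realization" and c: "c \<in> realization"
    and eq: "sgn (combination b) = sgn (combination c)"
  define t where "t = norm (combination c) / norm (combination b)"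
  have t: "0 < t"
    using combination_nonzero b c by (simp add: t_def)
  have "combination c = norm (combination c) *\<^sub>R sgn (combination b)"
    using eq combination_nonzero [OF c] by (simp add: sgn_div_norm)
  also have "\<dots> = t *\<^sub>R combination b"
    by (simp add: sgn_div_norm t_def divide_inverse)
  finally have cb: "combination c = t *\<^sub>R combination b" .
  then have bc: "combination b = (1 / t) *\<^sub>R combination c"
    using t by simp
  have "t = 1"
    using combination_scaled [OF b c t cb] combination_scaled [OF c b _ bc] t by simp
  then show "b = c"
    using cb inj_on_combination b c by (simp add: inj_on_def)
qed

lemma sgn_combination_image: "(\<lambda>b. sgn (combination b)) ` realization = sphere 0 1"
proof
  show "(\<lambda>b. sgn (combination b)) ` realization \<subseteq> sphere 0 1"
    using combination_nonzero by (auto simp: norm_sgn)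
  show "sphere 0 1 \<subseteq> (\<lambda>b. sgn (combination b)) ` realization"
  proof
    fix x :: 'a assume x: "x \<in> sphere 0 1"
    then have "x \<noteq> 0"
      by auto
    obtain n c where c: "n \<in> N" "\<And>v. v \<in> facet n \<Longrightarrow> 0 \<le> c v" "x = (\<Sum>v\<in>facet n. c v *\<^sub>R v)"
      "n \<bullet> x = (\<Sum>v\<in>facet n. c v)" "\<And>m. m \<in> N \<Longrightarrow> m \<bullet> x \<le> n \<bullet> x"
      by (rule in_facet_cone [of x]) blast
    define t where "t = n \<bullet> x"
    obtain m where "m \<in> N" "0 < m \<bullet> x"
      using facet_inner_pos [OF \<open>x \<noteq> 0\<close>] by blast
    then have t: "0 < t"
      using c(5) [of m] by (simp add: t_def)
    \<comment> \<open>The barycentric coordinates of \<open>x\<close> divided by \<open>t\<close>,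
      its radial projection onto the facet of \<open>n\<close>, extended by 0.\<close>
    define b where "b v = (if v \<in> facet n then c v / t else 0)" for v
    have restrict: "(\<Sum>v\<in>V. if v \<in> facet n then f v else 0) = (\<Sum>v\<in>facet n. f v)"
      for f :: "'a \<Rightarrow> 'b::comm_monoid_add"
      using finite_V by (simp add: sum.inter_filter facet_def)
    have "sum b V = (\<Sum>v\<in>facet n. c v / t)"
      unfolding b_def by (rule restrict)
    also have "\<dots> = 1"
      using c(4) t by (simp add: t_def sum_divide_distrib [symmetric])
    finally have b: "b \<in> realization"
      using c(1,2) t by (auto simp: realization_def faces_def b_def)
    have "combination b = (\<Sum>v\<in>V. if v \<in> facet n then (c v / t) *\<^sub>R v else 0)"
      unfolding combination_def b_def by (intro sum.cong) auto
    also have "\<dots> = (\<Sum>v\<in>facet n. (c v / t) *\<^sub>R v)"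
      by (rule restrict)
    also have "\<dots> = (1 / t) *\<^sub>R x"
      unfolding c(3) by (simp add: scaleR_sum_right)
    finally have "sgn (combination b) = x"
      using t x by (simp add: sgn_scaleR) (simp add: sgn_div_norm)
    then show "x \<in> (\<lambda>b. sgn (combination b)) ` realization"
      using b by blast
  qed
qed

section \<open>The antipodal involution and the folding of coordinates\<close>

lemma sum_uminus: "(\<Sum>v\<in>V. f (- v)) = (\<Sum>v\<in>V. f v)"
  using uminus_V by (intro sum.reindex_bij_witness [of _ uminus uminus]) auto

lemma realization_uminus: "b \<in> realization \<Longrightarrow> (\<lambda>v. b (- v)) \<in> realization"
  using sum_uminus [of b] by (simp add: realization_def support_uminus uminus_face)

lemma combination_uminus: "combination (\<lambda>v. b (- v)) = - combination b"
  using sum_uminus [of "\<lambda>v. b v *\<^sub>R - v"] by (simp add: combination_def sum_negf)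

text \<open>The map of realizations induced by the identification: a class receives the total weight
  of its two points. The default 0 is needed because the coordinates of the quotient are indexed by
  all sets, not only by classes of points of \<open>V\<close>.\<close>

definition fold_coordinates :: "('a \<Rightarrow> real) \<Rightarrow> 'a set \<Rightarrow> real" where
  "fold_coordinates b A = (if A \<in> antipodal_class ` V then sum b A else 0)"

lemma uminus_neq:
  assumes "v \<in> V"
  shows "- v \<noteq> v"
proof -
  obtain n where n: "n \<in> N" "v \<in> facet n"
    using in_facet [OF assms] .
  then have "facet n \<in> faces"
    by (auto simp: faces_def)
  then show ?thesis
    using uminus_notin_face n(2) by metis
qed

lemma fold_coordinates_class: "v \<in> V \<Longrightarrow> fold_coordinates b (antipodal_class v) = b v + b (- v)"
  using uminus_neq [of v] by (simp add: fold_coordinates_def antipodal_class_def)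

lemma continuous_on_fold_coordinates: "continuous_on A fold_coordinates"
proof (rule continuous_on_coordinatewise_then_product)
  show "continuous_on A (\<lambda>b. fold_coordinates b C)" for C
    by (cases "C \<in> antipodal_class ` V")
      (auto simp: fold_coordinates_def intro!: continuous_intros continuous_on_coordinate)
qed

text \<open>The weights are nonnegative, so the two weights added in a class cannot cancel.\<close>

lemma fold_coordinates_support:
  assumes b: "b \<in> realization"
  shows "{A. fold_coordinates b A \<noteq> 0} = antipodal_class ` {v. b v \<noteq> 0}"
proof -
  have V: "{v. b v \<noteq> 0} \<subseteq> V"
    using face_subset [OF realization_support [OF b]] .
  have nz: "fold_coordinates b (antipodal_class v) \<noteq> 0 \<longleftrightarrow> b v \<noteq> 0 \<or> b (- v) \<noteq> 0" if "v \<in> V" for v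
    using fold_coordinates_class [OF that] realization_nonneg [OF b]
    by (simp add: add_nonneg_eq_0_iff)
  show ?thesis
  proof
    show "antipodal_class ` {v. b v \<noteq> 0} \<subseteq> {A. fold_coordinates b A \<noteq> 0}"
      using V nz by auto
    show "{A. fold_coordinates b A \<noteq> 0} \<subseteq> antipodal_class ` {v. b v \<noteq> 0}"
    proof clarify
      fix A assume A: "fold_coordinates b A \<noteq> 0"
      then obtain v where v: "v \<in> V" "A = antipodal_class v"
        by (auto simp: fold_coordinates_def split: if_splits)
      then have "b v \<noteq> 0 \<or> b (- v) \<noteq> 0"
        using nz A by blast
      moreover have "A = antipodal_class (- v)"
        using v(2) by (simp add: antipodal_class_uminus)
      ultimately show "A \<in> antipodal_class ` {v. b v \<noteq> 0}"
        using v(2) by blast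
    qed
  qed
qed

text \<open>A face never contains an antipodal pair, so on the support folding merely renames
  coordinates.\<close>

lemma fold_coordinates_face:
  assumes b: "b \<in> realization" and v: "b v \<noteq> 0"
  shows "fold_coordinates b (antipodal_class v) = b v"
proof -
  have "v \<in> V"
    using face_subset [OF realization_support [OF b]] v by auto
  moreover have "b (- v) = 0"
    using uminus_notin_face [OF realization_support [OF b], of v] v by simp
  ultimately show ?thesis
    by (simp add: fold_coordinates_class)
qed

lemma fold_coordinates_uminus: "fold_coordinates (\<lambda>v. b (- v)) = fold_coordinates b"
proof
  fix A
  show "fold_coordinates (\<lambda>v. b (- v)) A = fold_coordinates b A"
  proof (cases "A \<in> antipodal_class ` V")
    case True
    then obtain v where "v \<in> V" "A = antipodal_class v"
      by blast
    then show ?thesis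
      by (simp add: fold_coordinates_class)
  next
    case False
    then show ?thesis
      by (simp add: fold_coordinates_def)
  qed
qed

lemma fold_coordinates_eq_imp:
  assumes b: "b \<in> realization" and c: "c \<in> realization"
    and eq: "fold_coordinates b = fold_coordinates c" and supp: "{v. c v \<noteq> 0} = {v. b v \<noteq> 0}"
  shows "b = c"
proof
  fix v
  show "b v = c v"
    using fold_coordinates_face [OF b, of v] fold_coordinates_face [OF c, of v] eq supp
    by (cases "b v = 0") auto
qed

text \<open>Equal folded coordinates give supports with the same classes, hence supports that are
  equal or antipodal. Once the supports are aligned by the involution, the weights can be read
  off.\<close>

lemma fold_coordinates_eq_iff:
  assumes b: "b \<in> realization" and c: "c \<in> realization"
  shows "fold_coordinates b = fold_coordinates c \<longleftrightarrow> c = b \<or> c = (\<lambda>v. b (- v))"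
proof
  assume eq: "fold_coordinates b = fold_coordinates c"
  then have "antipodal_class ` {v. b v \<noteq> 0} = antipodal_class ` {v. c v \<noteq> 0}"
    using fold_coordinates_support b c by metis
  then consider "{v. c v \<noteq> 0} = {v. b v \<noteq> 0}" | "{v. c v \<noteq> 0} = uminus ` {v. b v \<noteq> 0}"
    using face_class_cases realization_support b c by metis
  then show "c = b \<or> c = (\<lambda>v. b (- v))"
  proof cases
    case 1
    then show ?thesis
      using fold_coordinates_eq_imp [OF b c eq] by simp
  next
    case 2
    then show ?thesis
      using fold_coordinates_eq_imp [OF realization_uminus [OF b] c] eq
      by (simp add: fold_coordinates_uminus support_uminus)
  qed
qed (auto simp: fold_coordinates_uminus)

text \<open>The antipode of a projected point is the projection of the mirrored coordinates, so
  injectivity of the projection gives the same fibres as for folding.\<close>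

lemma sgn_combination_class_eq_iff:
  assumes b: "b \<in> realization" and c: "c \<in> realization"
  shows "antipodal_class (sgn (combination b)) = antipodal_class (sgn (combination c)) \<longleftrightarrow>
    c = b \<or> c = (\<lambda>v. b (- v))"
proof -
  have "sgn (combination c) = - sgn (combination b) \<longleftrightarrow>
      sgn (combination c) = sgn (combination (\<lambda>v. b (- v)))"
    by (simp add: combination_uminus sgn_minus)
  then show ?thesis
    using inj_on_eq_iff [OF inj_on_sgn_combination] b c realization_uminus [OF b]
    by (simp add: antipodal_class_eq_iff)
qed

lemma fold_coordinates_image:
  "fold_coordinates ` realization =
    {y. (\<forall>A. 0 \<le> y A) \<and> {A. y A \<noteq> 0} \<in> antipodal_quotient faces \<and> (\<Sum>A | y A \<noteq> 0. y A) = 1}"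
    (is "_ = ?Q")
proof
  show "fold_coordinates ` realization \<subseteq> ?Q"
  proof clarify
    fix b assume b: "b \<in> realization"
    have "0 \<le> fold_coordinates b A" for A
      using realization_nonneg [OF b] by (simp add: fold_coordinates_def sum_nonneg)
    moreover have "(\<Sum>A | fold_coordinates b A \<noteq> 0. fold_coordinates b A) =
        (\<Sum>v | b v \<noteq> 0. fold_coordinates b (antipodal_class v))"
      unfolding fold_coordinates_support [OF b]
      by (intro sum.reindex_cong [OF inj_on_face [OF realization_support [OF b]]]) auto
    moreover have "\<dots> = sum b V"
      using fold_coordinates_face [OF b] sum_support [OF realization_support [OF b]] by simp
    ultimately show "(\<forall>A. 0 \<le> fold_coordinates b A) \<and>
        {A. fold_coordinates b A \<noteq> 0} \<in> antipodal_quotient faces \<and>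
        (\<Sum>A | fold_coordinates b A \<noteq> 0. fold_coordinates b A) = 1"
      using realization_support [OF b] realization_sum [OF b]
      by (auto simp: fold_coordinates_support [OF b] antipodal_quotient_def)
  qed
  show "?Q \<subseteq> fold_coordinates ` realization"
  proof clarify
    fix y :: "'a set \<Rightarrow> real"
    assume nonneg: "\<forall>A. 0 \<le> y A" and supp: "{A. y A \<noteq> 0} \<in> antipodal_quotient faces"
      and sum: "(\<Sum>A | y A \<noteq> 0. y A) = 1"
    obtain S where S: "S \<in> faces" "{A. y A \<noteq> 0} = antipodal_class ` S"
      using supp by (auto simp: antipodal_quotient_def)
    \<comment> \<open>A lift of \<open>y\<close>: a face \<open>S\<close> over the support is
      chosen, and each of its vertices takes the weight of its class.\<close>
    define b where "b v = (if v \<in> S then y (antipodal_class v) else 0)" for v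
    have suppb: "{v. b v \<noteq> 0} = S"
      using S(2) by (auto simp: b_def)
    have "sum b V = (\<Sum>v\<in>S. y (antipodal_class v))"
      using sum_support [of b] suppb S(1) by (simp add: b_def)
    also have "\<dots> = 1"
      using sum S(2) by (simp add: sum.reindex [OF inj_on_face [OF S(1)]])
    finally have b: "b \<in> realization"
      using nonneg S(1) suppb by (simp add: realization_def) (simp add: b_def)
    have "fold_coordinates b A = y A" for A
    proof (cases "A \<in> antipodal_class ` S")
      case True
      then obtain v where v: "v \<in> S" "A = antipodal_class v"
        by blast
      then have "b v \<noteq> 0"
        using suppb by blast
      then show ?thesis
        using fold_coordinates_face [OF b, of v] v by (simp add: b_def)
    next
      case False
      then show ?thesis
        using fold_coordinates_support [OF b] suppb S(2) by (metis (mono_tags, lifting) mem_Collect_eq)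
    qed
    then have "fold_coordinates b = y"
      by (rule ext)
    then show "y \<in> fold_coordinates ` realization"
      using b by blast
  qed
qed

section \<open>The quotient complex and projective space as quotients of one realization\<close>

lemma triangulates_hull:
  "triangulates (antipodal_quotient (boundary_complex (convex hull V)))
     (real_projective_space :: 'a set topology)"
proof -
  have "abstract_simplicial_complex (antipodal_quotient faces)"
    unfolding abstract_simplicial_complex_def antipodal_quotient_def
  proof (intro conjI ballI allI impI)
    show "finite ((`) antipodal_class ` faces)"
      using finite_faces by simp
    fix S assume "S \<in> (`) antipodal_class ` faces"
    then obtain T where T: "T \<in> faces" "S = antipodal_class ` T"
      by blast
    show "finite S"
      using T finite_face by simp
    fix U assume "U \<subseteq> S"
    then obtain W where "W \<subseteq> T" "U = antipodal_class ` W"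
      using T(2) subset_imageE by metis
    then show "U \<in> (`) antipodal_class ` faces"
      using subset_face T(1) by blast
  qed
  moreover have "geometric_realization (antipodal_quotient faces) homeomorphic_space
      (real_projective_space :: 'a set topology)"
  proof (rule homeomorphic_space_quotient_maps)
    let ?R = "top_of_set realization"
    have compact: "compact_space ?R"
      using compact_realization by (simp add: compact_space_subtopology)
    have Q: "geometric_realization (antipodal_quotient faces) = top_of_set (fold_coordinates ` realization)"
      by (simp add: geometric_realization_def fold_coordinates_image)
    have Hausdorff_fun: "Hausdorff_space (euclidean :: ('a set \<Rightarrow> real) topology)"
      unfolding euclidean_product_topology [symmetric] Hausdorff_space_product_topology by simp
    \<comment> \<open>A continuous surjection from a compact space onto a Hausdorff space is a
      quotient map; the same argument serves for the projection to the sphere below.\<close>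
    show "quotient_map ?R (geometric_realization (antipodal_quotient faces)) fold_coordinates"
      unfolding Q using compact continuous_on_fold_coordinates Hausdorff_fun
      by (intro continuous_imp_quotient_map)
        (auto simp: Hausdorff_space_subtopology continuous_map_in_subtopology)
    have "continuous_on realization (\<lambda>b. sgn (combination b))"
      using combination_nonzero
      by (intro continuous_on_sgn continuous_on_combination) auto
    then have "quotient_map ?R (top_of_set (sphere 0 1)) (\<lambda>b. sgn (combination b))"
      using compact sgn_combination_image
      by (intro continuous_imp_quotient_map)
        (auto simp: Hausdorff_space_subtopology continuous_map_in_subtopology)
    then show "quotient_map ?R (real_projective_space :: 'a set topology)
        (antipodal_class \<circ> (\<lambda>b. sgn (combination b)))"
      unfolding real_projective_space_def
      by (rule quotient_map_compose [OF _ quotient_map_quotient_topology])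
    show "fold_coordinates b = fold_coordinates c \<longleftrightarrow>
        (antipodal_class \<circ> (\<lambda>b. sgn (combination b))) b = (antipodal_class \<circ> (\<lambda>b. sgn (combination b))) c"
      if "b \<in> topspace ?R" "c \<in> topspace ?R" for b c
      using that fold_coordinates_eq_iff sgn_combination_class_eq_iff by simp
  qed
  ultimately show ?thesis
    by (simp add: triangulates_def boundary_complex_eq)
qed

end

section \<open>Orbits of facet normals\<close>

definition symmetries :: "'a::real_inner set \<Rightarrow> ('a \<Rightarrow> 'a) set" where
  "symmetries V = {g. (\<forall>x y. g x \<bullet> g y = x \<bullet> y) \<and> g ` V = V}"

text \<open>The squared distance of two points expands into inner products, so no linearity has to
  be assumed of \<open>g\<close>.\<close>

lemma inner_preserving_inj:
  fixes g :: "'a::real_inner \<Rightarrow> 'b::real_inner"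
  assumes "\<And>x y. g x \<bullet> g y = x \<bullet> y"
  shows "inj g"
proof
  fix x y assume "g x = g y"
  then have "(x - y) \<bullet> (x - y) = 0"
    using assms [of x x] assms [of x y] assms [of y y]
    by (simp add: inner_diff_left inner_diff_right inner_commute)
  then show "x = y"
    by simp
qed

text \<open>A symmetry \<open>g\<close> carries the tight set of \<open>n\<close> to that of
  \<open>g n\<close>, so each condition can be pulled back to a representative. If the
  representative pivots to \<open>h m\<close>, then its image under \<open>g\<close> pivots to
  \<open>g (h m)\<close>, which is again in the orbit.\<close>

lemma antipodal_certificate_orbits:
  fixes V N :: "'a::euclidean_space set"
  assumes "finite V" "N \<noteq> {}" and uminus_V: "\<And>v. v \<in> V \<Longrightarrow> - v \<in> V"
    and norm_V: "\<And>v. v \<in> V \<Longrightarrow> norm v = r"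
    and le_1: "\<And>n v. n \<in> N \<Longrightarrow> v \<in> V \<Longrightarrow> n \<bullet> v \<le> 1"
    and card: "\<And>n. n \<in> N \<Longrightarrow> card {v \<in> V. n \<bullet> v = 1} = DIM('a)"
    and pivot: "\<And>n v. n \<in> N \<Longrightarrow> v \<in> V \<Longrightarrow> n \<bullet> v = 1 \<Longrightarrow>
      \<exists>g\<in>symmetries V. \<exists>m\<in>N. g m \<bullet> v \<noteq> 1 \<and> (\<forall>w\<in>V. n \<bullet> w = 1 \<and> w \<noteq> v \<longrightarrow> g m \<bullet> w = 1)"
    and acute: "\<And>n v w. n \<in> N \<Longrightarrow> v \<in> V \<Longrightarrow> n \<bullet> v = 1 \<Longrightarrow> w \<in> V \<Longrightarrow> n \<bullet> w = 1 \<Longrightarrow> 0 < v \<bullet> w"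
  shows "antipodal_certificate V (\<Union>g\<in>symmetries V. g ` N) r"
proof
  let ?N = "\<Union>g\<in>symmetries V. g ` N"
  have inner: "g x \<bullet> g y = x \<bullet> y" and image: "g ` V = V" if "g \<in> symmetries V" for g x y
    using that by (auto simp: symmetries_def)
  have inj: "inj g" if "g \<in> symmetries V" for g
    using inner_preserving_inj inner [OF that] by blast
  have preimage: "\<exists>u\<in>V. v = g u" if "g \<in> symmetries V" "v \<in> V" for g v
    using image [OF that(1)] that(2) by blast
  have id: "id \<in> symmetries V"
    by (simp add: symmetries_def)
  then show "?N \<noteq> {}"
    using \<open>N \<noteq> {}\<close> by blast
  fix n assume "n \<in> ?N"
  then obtain g n0 where g: "g \<in> symmetries V" and n0: "n0 \<in> N" and n: "n = g n0"
    by blast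
  show "n \<bullet> v \<le> 1" if v: "v \<in> V" for v
    using preimage [OF g v] le_1 [OF n0] n by (auto simp: inner [OF g])
  have "{v \<in> V. n \<bullet> v = 1} = g ` {v \<in> V. n0 \<bullet> v = 1}"
  proof
    show "{v \<in> V. n \<bullet> v = 1} \<subseteq> g ` {v \<in> V. n0 \<bullet> v = 1}"
    proof clarify
      fix v assume v: "v \<in> V" "n \<bullet> v = 1"
      then obtain u where "u \<in> V" "v = g u"
        using preimage [OF g] by blast
      then show "v \<in> g ` {v \<in> V. n0 \<bullet> v = 1}"
        using v(2) n by (simp add: inner [OF g])
    qed
    show "g ` {v \<in> V. n0 \<bullet> v = 1} \<subseteq> {v \<in> V. n \<bullet> v = 1}"
      using image [OF g] n by (auto simp: inner [OF g])
  qed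
  then show "card {v \<in> V. n \<bullet> v = 1} = DIM('a)"
    using card [OF n0] inj [OF g] by (simp add: card_image inj_on_subset)
  show "\<exists>m\<in>?N. m \<bullet> v \<noteq> 1 \<and> (\<forall>w\<in>V. n \<bullet> w = 1 \<and> w \<noteq> v \<longrightarrow> m \<bullet> w = 1)"
    if v: "v \<in> V" and nv: "n \<bullet> v = 1" for v
  proof -
    obtain u where u: "u \<in> V" "v = g u"
      using preimage [OF g v] by blast
    then have "n0 \<bullet> u = 1"
      using nv n by (simp add: inner [OF g])
    then obtain h m where h: "h \<in> symmetries V" and m: "m \<in> N" "h m \<bullet> u \<noteq> 1"
      "\<And>w. w \<in> V \<Longrightarrow> n0 \<bullet> w = 1 \<Longrightarrow> w \<noteq> u \<Longrightarrow> h m \<bullet> w = 1"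
      using pivot [OF n0 u(1)] by blast
    have "(g \<circ> h) ` V = V"
      using image [OF g] image [OF h] image_comp [of g h V] by metis
    then have "g \<circ> h \<in> symmetries V"
      by (simp add: symmetries_def inner [OF g] inner [OF h])
    then have "g (h m) \<in> ?N"
      using m(1) by (metis UN_I comp_apply imageI)
    moreover have "g (h m) \<bullet> w = 1" if w: "w \<in> V" "n \<bullet> w = 1" "w \<noteq> v" for w
    proof -
      obtain w0 where "w0 \<in> V" "w = g w0"
        using preimage [OF g w(1)] by blast
      then show ?thesis
        using w m(3) [of w0] n u(2) by (auto simp: inner [OF g])
    qed
    ultimately show ?thesis
      using m(2) u(2) by (intro bexI [of _ "g (h m)"]) (auto simp: inner [OF g])
  qed
  \<comment> \<open>Composing with the antipodal map gives another symmetry, which makes the set of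
    normals closed under negation.\<close>
  have "(\<lambda>x. - g x) ` V = V"
  proof -
    have "uminus ` V = V"
      using uminus_V by force
    then show ?thesis
      using image [OF g] image_image [of uminus g V] by metis
  qed
  then have "(\<lambda>x. - g x) \<in> symmetries V"
    by (simp add: symmetries_def inner [OF g])
  then show "- n \<in> ?N"
    using n0 n by (metis UN_I imageI)
  show "0 < v \<bullet> w" if vw: "v \<in> V" "n \<bullet> v = 1" "w \<in> V" "n \<bullet> w = 1" for v w
  proof -
    obtain v0 where "v0 \<in> V" "v = g v0"
      using preimage [OF g vw(1)] by blast
    moreover obtain w0 where "w0 \<in> V" "w = g w0"
      using preimage [OF g vw(3)] by blast
    ultimately show ?thesis
      using vw acute [OF n0, of v0 w0] n by (simp add: inner [OF g])
  qed
qed (use assms in auto)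

section \<open>Signed permutations in dimension six\<close>

lemma vector_6:
  "(vector [a, b, c, d, e, f] :: 'a::zero ^ 6) $ 1 = a"
  "(vector [a, b, c, d, e, f] :: 'a ^ 6) $ 2 = b"
  "(vector [a, b, c, d, e, f] :: 'a ^ 6) $ 3 = c"
  "(vector [a, b, c, d, e, f] :: 'a ^ 6) $ 4 = d"
  "(vector [a, b, c, d, e, f] :: 'a ^ 6) $ 5 = e"
  "(vector [a, b, c, d, e, f] :: 'a ^ 6) $ 6 = f"
  unfolding vector_def by simp_all

lemma exhaust_6:
  fixes x :: 6
  shows "x = 1 \<or> x = 2 \<or> x = 3 \<or> x = 4 \<or> x = 5 \<or> x = 6"
proof (induct x)
  case (of_int z)
  then have "z = 0 \<or> z = 1 \<or> z = 2 \<or> z = 3 \<or> z = 4 \<or> z = 5"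
    by fastforce
  then show ?case
    by auto
qed

lemma forall_6: "(\<forall>i::6. P i) \<longleftrightarrow> P 1 \<and> P 2 \<and> P 3 \<and> P 4 \<and> P 5 \<and> P 6"
  by (metis exhaust_6)

lemma UNIV_6: "(UNIV :: 6 set) = {1, 2, 3, 4, 5, 6}"
  using exhaust_6 by auto

lemma sum_6: "sum f (UNIV :: 6 set) = f 1 + f 2 + f 3 + f 4 + f 5 + f 6"
  unfolding UNIV_6 by (simp add: ac_simps)

definition vec_of :: "int list \<Rightarrow> real ^ 6" where
  "vec_of xs = vector (map real_of_int xs)"

definition dot :: "int list \<Rightarrow> int list \<Rightarrow> int" where
  "dot xs ys = sum_list (map2 (*) xs ys)"

lemma length_6_cases:
  assumes "length xs = 6"
  obtains a b c d e f where "xs = [a, b, c, d, e, f]"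
  using assms by (auto simp: eval_nat_numeral length_Suc_conv)

lemma inner_vec_of:
  assumes "length xs = 6" "length ys = 6"
  shows "vec_of xs \<bullet> vec_of ys = dot xs ys"
  using assms by (elim length_6_cases) (simp add: inner_vec_def sum_6 vec_of_def vector_6 dot_def)

lemma vec_of_inject:
  assumes "length xs = 6" "length ys = 6"
  shows "vec_of xs = vec_of ys \<longleftrightarrow> xs = ys"
  using assms by (elim length_6_cases) (simp add: vec_eq_iff forall_6 vec_of_def vector_6)

lemma vec_of_uminus: "length xs = 6 \<Longrightarrow> vec_of (map uminus xs) = - vec_of xs"
  by (elim length_6_cases) (simp add: vec_eq_iff forall_6 vec_of_def vector_6)

text \<open>A list of signed indices \<open>\<plusminus> i\<close>, where \<open>1 \<le> i \<le> 6\<close>, encodes the map whose coordinates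
  are \<open>\<plusminus> x\<^sub>i\<close>; the index \<open>6\<close> is the numeral \<open>0\<close> of the index type.\<close>

definition signed_permutation :: "int list \<Rightarrow> real ^ 6 \<Rightarrow> real ^ 6" where
  "signed_permutation s x = vector (map (\<lambda>i. of_int (sgn i) * x $ of_int \<bar>i\<bar>) s)"

definition permute_signed :: "int list \<Rightarrow> int list \<Rightarrow> int list" where
  "permute_signed s xs = map (\<lambda>i. sgn i * xs ! nat (\<bar>i\<bar> - 1)) s"

text \<open>Sorting turns the requirement that the absolute values form a permutation into an
  executable test.\<close>

definition signed_indices :: "int list \<Rightarrow> bool" where
  "signed_indices s \<longleftrightarrow> sort (map abs s) = [1, 2, 3, 4, 5, 6]"

lemma signed_indices_length: "signed_indices s \<Longrightarrow> length s = 6"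
  unfolding signed_indices_def by (drule arg_cong [of _ _ length]) simp

lemma signed_indices_mset: "signed_indices s \<Longrightarrow> mset (map abs s) = {#1, 2, 3, 4, 5, 6#}"
  unfolding signed_indices_def by (drule arg_cong [of _ _ mset]) simp

lemma signed_indices_range: "signed_indices s \<Longrightarrow> i \<in> set s \<Longrightarrow> \<bar>i\<bar> \<in> {1, 2, 3, 4, 5, 6}"
  unfolding signed_indices_def
  by (drule arg_cong [of _ _ set]) (simp add: set_eq_iff image_iff, metis)

lemma length_permute_signed: "length (permute_signed s xs) = length s"
  by (simp add: permute_signed_def)

lemma inner_vector_map:
  fixes f g :: "'b \<Rightarrow> real"
  assumes "length s = 6"
  shows "(vector (map f s) :: real ^ 6) \<bullet> vector (map g s) = (\<Sum>i\<leftarrow>s. f i * g i)"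
  using assms by (elim length_6_cases) (simp add: inner_vec_def sum_6 vector_6)

text \<open>The signs square to 1, and the remaining sum of products depends only on the multiset of
  indices.\<close>

lemma inner_signed_permutation:
  assumes s: "signed_indices s"
  shows "signed_permutation s x \<bullet> signed_permutation s y = x \<bullet> y"
proof -
  have "i \<noteq> 0" if "i \<in> set s" for i
    using signed_indices_range [OF s that] by auto
  then have "of_int (sgn i) * of_int (sgn i) = (1 :: real)" if "i \<in> set s" for i
    using that by (auto simp: sgn_if)
  then have "signed_permutation s x \<bullet> signed_permutation s y =
      (\<Sum>i\<leftarrow>s. x $ of_int \<bar>i\<bar> * y $ of_int \<bar>i\<bar>)"
    unfolding signed_permutation_def inner_vector_map [OF signed_indices_length [OF s]]
    by (intro arg_cong [of _ _ sum_list] map_cong) (simp_all add: algebra_simps)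
  also have "\<dots> = (\<Sum>i\<in>#mset (map abs s). x $ of_int i * y $ of_int i)"
    by (simp flip: sum_mset_sum_list add: multiset.map_comp comp_def)
  also have "\<dots> = x \<bullet> y"
    unfolding signed_indices_mset [OF s] by (simp add: inner_vec_def sum_6)
  finally show ?thesis .
qed

lemma signed_permutation_scaleR:
  assumes "signed_indices s"
  shows "signed_permutation s (c *\<^sub>R x) = c *\<^sub>R signed_permutation s x"
  using signed_indices_length [OF assms]
  by (elim length_6_cases) (simp add: vec_eq_iff forall_6 signed_permutation_def vector_6)

lemma vec_of_nth:
  assumes "length xs = 6" "i \<in> {1, 2, 3, 4, 5, 6}"
  shows "vec_of xs $ of_int i = xs ! nat (i - 1)"
  using assms by (elim length_6_cases) (auto simp: vec_of_def vector_6)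

lemma signed_permutation_vec_of:
  assumes "signed_indices s" "length xs = 6"
  shows "signed_permutation s (vec_of xs) = vec_of (permute_signed s xs)"
proof -
  have eq: "map (\<lambda>i. of_int (sgn i) * vec_of xs $ of_int \<bar>i\<bar>) s =
      map (\<lambda>i. real_of_int (sgn i * xs ! nat (\<bar>i\<bar> - 1))) s"
    using vec_of_nth [OF assms(2) signed_indices_range [OF assms(1)]]
    by (intro map_cong) (simp_all del: of_int_abs)
  show ?thesis
    unfolding signed_permutation_def eq by (simp add: vec_of_def permute_signed_def comp_def)
qed

section \<open>The certificate for the polytope with 48 vertices\<close>

text \<open>Scaling by 7 clears the denominators of the given points.\<close>

definition half_points :: "int list list" where
  "half_points =
    [[0, 5, 3, 4, 0, 0],
     [3, 0, 0, -5, -4, 0],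
     [4, 5, -3, 0, 0, 0],
     [-4, 5, -3, 0, 0, 0],
     [-5, 0, 0, -3, -4, 0],
     [0, 0, 4, 0, 3, -5],
     [0, 0, 4, 0, -5, -3],
     [-5, 0, 0, -3, 4, 0],
     [0, 4, 0, 0, -3, -5],
     [0, -5, -3, 4, 0, 0],
     [0, -4, 0, 0, 5, -3],
     [0, -4, 0, 0, -5, 3],
     [-5, 0, 0, 3, 0, 4],
     [-5, 0, 0, 3, 0, -4],
     [0, 0, 4, 0, -3, 5],
     [3, 0, 0, 5, 0, 4],
     [0, 3, -5, 4, 0, 0],
     [3, 0, 0, -5, 4, 0],
     [4, -3, -5, 0, 0, 0],
     [0, 4, 0, 0, 3, 5],
     [0, 0, 4, 0, 5, 3],
     [4, 3, 5, 0, 0, 0],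
     [3, 0, 0, 5, 0, -4],
     [0, 3, -5, -4, 0, 0]]"

definition points :: "int list list" where
  "points = half_points @ map (map uminus) half_points"

text \<open>Up to symmetry there are twelve facets. The pair \<open>(n, d)\<close> stands for the facet
  \<open>n \<bullet> x = d\<close> of the polytope scaled by \<open>7\<close>.\<close>

definition normals :: "(int list \<times> int) list" where
  "normals =
    [([-37, 64, -16, 61, -25, -37], 516),
     ([-8, 0, -6, 32, -31, -43], 308),
     ([-60, 101, -233, 240, -88, -352], 2428),
     ([-88, -68, -272, 352, -135, -267], 2564),
     ([-1, 1, -1, 1, -1, -1], 12),
     ([16, 39, -27, 64, -59, -35], 508),
     ([-1, -1, -1, 1, -1, -1], 12),
     ([-56, 0, -51, -14, -34, -136], 782),
     ([1, -1, -4, 4, -4, 1], 33),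
     ([-1, 0, 0, 1, -2, -2], 16),
     ([0, 0, 0, 4, -5, -5], 40),
     ([4, 0, 0, -1, -17, 0], 85)]"

text \<open>An entry \<open>(k, s)\<close> is the image of the \<open>k\<close>-th facet under the signed permutation \<open>s\<close>.\<close>

definition neighbours :: "(nat \<times> int list) list list" where
  "neighbours =
    [[(4, [5, 4, 1, -6, -2, 3]), (2, [5, 4, 1, -6, -2, 3]),
      (1, [5, 4, 1, -6, -2, 3]), (2, [-2, -6, 5, -3, -4, 1]),
      (5, [5, 4, 1, -6, -2, 3]), (3, [5, 4, 1, -6, -2, 3])],
     [(5, [-1, 3, -2, 4, 6, 5]), (10, [-1, -3, 2, 4, 6, 5]),
      (9, [1, -2, -3, 4, 5, 6]), (7, [4, -2, 3, -1, 5, 6]),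
      (0, [3, -5, 6, 2, 1, -4]), (1, [1, -2, -3, 4, 5, 6])],
     [(8, [2, -6, 5, -3, -1, -4]), (5, [2, -6, 5, -3, -1, -4]),
      (7, [4, -2, 3, -1, 5, 6]), (0, [6, -1, -4, -5, 3, -2]),
      (0, [3, -5, 6, 2, 1, -4]), (3, [2, -6, 5, -3, -1, -4])],
     [(0, [3, -5, 6, 2, 1, -4]), (2, [-5, 1, -4, -6, 3, -2]),
      (5, [-1, 3, -2, 4, 6, 5]), (5, [6, -1, -4, -5, 3, -2]),
      (8, [2, -6, 5, -3, -1, -4]), (7, [5, 4, 1, -6, -2, 3])],
     [(0, [3, -5, 6, 2, 1, -4]), (0, [-4, -3, -2, -1, 6, 5]),
      (0, [5, 4, 1, -6, -2, 3]), (0, [-2, -6, 5, -3, -4, 1]),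
      (0, [6, -1, -4, -5, 3, -2]), (0, [1, 2, 3, 4, 5, 6])],
     [(2, [-5, 1, -4, -6, 3, -2]), (1, [-1, -3, 2, 4, 6, 5]),
      (3, [-2, -6, 5, -3, -4, 1]), (0, [3, -5, 6, 2, 1, -4]),
      (6, [-1, -3, 2, 4, 6, 5]), (3, [-1, -3, 2, 4, 6, 5])],
     [(5, [-4, -2, 3, 1, 5, 6]), (5, [-2, 5, 6, -3, -4, -1]),
      (5, [3, 6, 5, 2, -1, -4]), (5, [6, -1, -4, -5, 3, -2]),
      (5, [5, -4, -1, -6, -2, 3]), (5, [-1, 3, -2, 4, 6, 5])],
     [(2, [-4, -2, 3, 1, 5, 6]), (7, [-4, -2, 3, 1, 5, 6]),
      (1, [-4, -2, 3, 1, 5, 6]), (7, [4, -2, 3, -1, 5, 6]),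
      (3, [3, -5, 6, 2, 1, -4]), (11, [-1, -3, 2, 4, 6, 5])],
     [(2, [-1, 2, 3, 4, 6, -5]), (3, [-2, 5, 6, -3, -4, -1]),
      (2, [-5, 1, -4, -6, 3, -2]), (2, [-2, 5, 6, -3, -4, -1]),
      (3, [-5, 1, -4, -6, 3, -2]), (3, [-1, 2, 3, 4, 6, -5])],
     [(1, [1, 2, 3, 4, 5, 6]), (1, [-4, 3, 2, -1, 6, 5]),
      (10, [-1, -3, 2, 4, 6, 5]), (10, [-4, -2, 3, 1, 5, 6]),
      (1, [-4, -3, -2, -1, 6, 5]), (1, [1, -2, -3, 4, 5, 6])],
     [(1, [1, 2, 3, 4, 5, 6]), (1, [-1, 3, -2, 4, 6, 5]),
      (9, [1, -2, -3, 4, 5, 6]), (9, [-1, -3, 2, 4, 6, 5]),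
      (1, [-1, -3, 2, 4, 6, 5]), (1, [1, -2, -3, 4, 5, 6])],
     [(11, [-4, -2, 3, 1, 5, 6]), (7, [-1, 2, 3, 4, 6, -5]),
      (7, [-1, -3, 2, 4, 6, 5]), (11, [4, -2, 3, -1, 5, 6]),
      (7, [-1, 3, -2, 4, 6, 5]), (7, [-1, -2, -3, 4, 6, -5])]]"

section \<open>Integer checks of facets, pivots and symmetries\<close>

definition tight :: "int list \<Rightarrow> int \<Rightarrow> int list list" where
  "tight n d = filter (\<lambda>v. dot n v = d) points"

text \<open>A signed permutation preserves inner products and the point set, so a moved normal keeps
  its right-hand side \<open>e\<close>. The pivot at \<open>v\<close> is searched for in the row
  \<open>nbs\<close>, whose order therefore does not matter.\<close>

definition check_facet :: "int list \<times> int \<Rightarrow> (nat \<times> int list) list \<Rightarrow> bool" where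
  "check_facet nd nbs \<longleftrightarrow> (case nd of (n, d) \<Rightarrow>
     0 < d \<and> length n = 6 \<and> list_all (\<lambda>v. dot n v \<le> d) points \<and>
     (let T = tight n d in
       length T = 6 \<and> list_all (\<lambda>v. list_all (\<lambda>w. 0 < dot v w) T) T \<and>
       list_all (\<lambda>v. list_ex (\<lambda>(k, s). case normals ! k of (m, e) \<Rightarrow>
         let gm = permute_signed s m in
           dot gm v \<noteq> e \<and> list_all (\<lambda>w. w \<noteq> v \<longrightarrow> dot gm w = e) T) nbs) T))"

text \<open>Testing one point from each antipodal pair is enough, since signed permutations commute
  with negation.\<close>

definition check_symmetry :: "nat \<times> int list \<Rightarrow> bool" where
  "check_symmetry ks \<longleftrightarrow> (case ks of (k, s) \<Rightarrow> k < length normals \<and> signed_indices s \<and>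
     list_all (\<lambda>v. permute_signed s v \<in> set points) half_points)"

lemma check_facets: "list_all2 check_facet normals neighbours"
  by code_simp

lemma check_symmetries: "list_all (list_all check_symmetry) neighbours"
  by code_simp

text \<open>The value 50 is 9 + 16 + 25, from the entries 3, 4, 5 up to sign. Distinctness lets the
  length of a list of tight points count the points themselves.\<close>

lemma check_points: "distinct points" "list_all (\<lambda>v. length v = 6 \<and> dot v v = 50) points"
  by code_simp+

section \<open>From the integer data to the polytope\<close>

definition point_of :: "int list \<Rightarrow> real ^ 6" where
  "point_of x = (1 / 7) *\<^sub>R vec_of x"

text \<open>The factor 7 cancels the 1/7 of \<open>point_of\<close>, and division by
  \<open>d\<close> puts the supporting hyperplane at level 1.\<close>

definition normal_of :: "int list \<Rightarrow> int \<Rightarrow> real ^ 6" where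
  "normal_of n d = (7 / of_int d) *\<^sub>R vec_of n"

lemma half_points_6_48_eq: "half_points_6_48 = map point_of half_points"
proof -
  have "point_of [a, b, c, d, e, f] = vector [a / 7, b / 7, c / 7, d / 7, e / 7, f / 7]"
    for a b c d e f
    by (simp add: point_of_def vec_of_def vec_eq_iff forall_6 vector_6)
  then show ?thesis
    by (simp add: half_points_6_48_def half_points_def Let_def)
qed

lemma length_points: "x \<in> set points \<Longrightarrow> length x = 6"
  and dot_points: "x \<in> set points \<Longrightarrow> dot x x = 50"
  using check_points(2) by (auto simp: list_all_iff)

lemma half_points_subset: "set half_points \<subseteq> set points"
  by (auto simp: points_def)

lemma point_of_uminus: "length x = 6 \<Longrightarrow> point_of (map uminus x) = - point_of x"
  by (simp add: point_of_def vec_of_uminus)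

lemma points_6_48_eq: "points_6_48 = point_of ` set points"
proof -
  have "point_of ` map uminus ` set half_points = uminus ` point_of ` set half_points"
    unfolding image_image using half_points_subset length_points
    by (intro image_cong refl point_of_uminus) auto
  then show ?thesis
    by (simp add: points_6_48_def half_points_6_48_eq points_def image_Un)
qed

lemma uminus_points_6_48: "v \<in> points_6_48 \<Longrightarrow> - v \<in> points_6_48"
  by (auto simp: points_6_48_def)

lemma finite_points_6_48: "finite points_6_48"
  by (simp add: points_6_48_def)

lemma inj_on_point_of: "inj_on point_of (set points)"
  using length_points by (auto simp: inj_on_def point_of_def vec_of_inject)

lemma norm_points_6_48:
  assumes "v \<in> points_6_48"
  shows "norm v = sqrt (50 / 49)"
proof -
  obtain x where "x \<in> set points" "v = point_of x"
    using assms points_6_48_eq by auto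
  then show ?thesis
    by (simp add: norm_eq_sqrt_inner point_of_def inner_vec_of length_points dot_points)
qed

lemma inner_normal_of_point_of:
  assumes "length n = 6" "length x = 6"
  shows "normal_of n d \<bullet> point_of x = dot n x / d"
  using assms by (simp add: normal_of_def point_of_def inner_vec_of)

lemma inner_point_of_pos:
  assumes "length x = 6" "length y = 6" "0 < dot x y"
  shows "0 < point_of x \<bullet> point_of y"
  using assms by (simp add: point_of_def inner_vec_of)

lemma facet_check:
  assumes "(n, d) \<in> set normals"
  obtains nbs where "nbs \<in> set neighbours" "check_facet (n, d) nbs"
  using check_facets assms by (metis in_set_conv_nth list_all2_conv_all_nth)

lemma normals_length: "(n, d) \<in> set normals \<Longrightarrow> length n = 6"
  and normals_pos: "(n, d) \<in> set normals \<Longrightarrow> 0 < d"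
  and normals_le: "(n, d) \<in> set normals \<Longrightarrow> x \<in> set points \<Longrightarrow> dot n x \<le> d"
  and length_tight: "(n, d) \<in> set normals \<Longrightarrow> length (tight n d) = 6"
  and tight_acute: "(n, d) \<in> set normals \<Longrightarrow> x \<in> set (tight n d) \<Longrightarrow> y \<in> set (tight n d) \<Longrightarrow> 0 < dot x y"
  by (erule facet_check, simp add: check_facet_def Let_def list_all_iff)+

lemma neighbour_check:
  assumes "nbs \<in> set neighbours" "(k, s) \<in> set nbs"
  shows "k < length normals" "signed_indices s"
    "x \<in> set half_points \<Longrightarrow> permute_signed s x \<in> set points"
  using check_symmetries assms by (fastforce simp: list_all_iff check_symmetry_def)+

lemma signed_permutation_point_of:
  assumes "signed_indices s" "length x = 6"
  shows "signed_permutation s (point_of x) = point_of (permute_signed s x)"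
  using assms by (simp add: point_of_def signed_permutation_scaleR signed_permutation_vec_of)

lemma signed_permutation_normal_of:
  assumes "signed_indices s" "length n = 6"
  shows "signed_permutation s (normal_of n d) = normal_of (permute_signed s n) d"
  using assms by (simp add: normal_of_def signed_permutation_scaleR signed_permutation_vec_of)

text \<open>The check on half of the points extends to all by oddness. An injective map of a finite
  set into itself is onto, so mapping into the point set suffices.\<close>

lemma neighbour_symmetry:
  assumes "nbs \<in> set neighbours" "(k, s) \<in> set nbs"
  shows "signed_permutation s \<in> symmetries points_6_48"
proof -
  note s = neighbour_check [OF assms]
  have half: "signed_permutation s (point_of x) \<in> points_6_48" if "x \<in> set half_points" for x
  proof -
    have "length x = 6"
      using that half_points_subset length_points by blast
    then show ?thesis
      using s(3) [OF that] by (simp add: signed_permutation_point_of [OF s(2)] points_6_48_eq)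
  qed
  have uminus: "signed_permutation s (- y) = - signed_permutation s y" for y
    using signed_permutation_scaleR [OF s(2), of "-1" y] by simp
  have "signed_permutation s ` points_6_48 \<subseteq> points_6_48"
  proof clarify
    fix v assume "v \<in> points_6_48"
    then obtain x where "x \<in> set half_points" "v = point_of x \<or> v = - point_of x"
      by (auto simp: points_6_48_def half_points_6_48_eq)
    then show "signed_permutation s v \<in> points_6_48"
      using half uminus_points_6_48 by (auto simp: uminus)
  qed
  moreover have "inj_on (signed_permutation s) points_6_48"
    using inner_preserving_inj [OF inner_signed_permutation [OF s(2)]] by (rule inj_on_subset) simp
  ultimately have "signed_permutation s ` points_6_48 = points_6_48"
    using finite_points_6_48 by (intro endo_inj_surj)
  then show ?thesis
    by (simp add: symmetries_def inner_signed_permutation [OF s(2)])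
qed

lemma normal_of_eq_1_iff:
  assumes "(n, d) \<in> set normals" "x \<in> set points"
  shows "normal_of n d \<bullet> point_of x = 1 \<longleftrightarrow> x \<in> set (tight n d)"
  using assms normals_pos [OF assms(1)]
  by (auto simp: inner_normal_of_point_of normals_length length_points tight_def)

lemma tight_subset: "set (tight n d) \<subseteq> set points"
  by (auto simp: tight_def)

lemma facet_points:
  assumes "(n, d) \<in> set normals"
  shows "{v \<in> points_6_48. normal_of n d \<bullet> v = 1} = point_of ` set (tight n d)"
  unfolding points_6_48_eq using normal_of_eq_1_iff [OF assms] tight_subset by blast

lemma card_facet_points:
  assumes "(n, d) \<in> set normals"
  shows "card {v \<in> points_6_48. normal_of n d \<bullet> v = 1} = 6"
proof -
  have "card (point_of ` set (tight n d)) = card (set (tight n d))"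
    by (intro card_image inj_on_subset [OF inj_on_point_of] tight_subset)
  also have "\<dots> = length (tight n d)"
    using check_points(1) by (intro distinct_card) (simp add: tight_def)
  finally show ?thesis
    by (simp add: facet_points [OF assms] length_tight [OF assms])
qed

text \<open>Turns a verified row of the table into the pivot required of a representative, with the
  signed permutation as the symmetry.\<close>

lemma facet_neighbour:
  assumes n: "(n, d) \<in> set normals" and x: "x \<in> set (tight n d)"
  obtains g m e where "g \<in> symmetries points_6_48" "(m, e) \<in> set normals"
    "g (normal_of m e) \<bullet> point_of x \<noteq> 1"
    "\<And>y. y \<in> set (tight n d) \<Longrightarrow> y \<noteq> x \<Longrightarrow> g (normal_of m e) \<bullet> point_of y = 1"
proof -
  obtain nbs where nbs: "nbs \<in> set neighbours" "check_facet (n, d) nbs"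
    using facet_check [OF n] .
  obtain ks where ks_in: "ks \<in> set nbs" and ks: "case normals ! fst ks of (m, e) \<Rightarrow>
      dot (permute_signed (snd ks) m) x \<noteq> e \<and>
      (\<forall>y\<in>set (tight n d). y \<noteq> x \<longrightarrow> dot (permute_signed (snd ks) m) y = e)"
    using nbs(2) x
    by (auto simp: check_facet_def Let_def list_all_iff list_ex_iff case_prod_unfold)
  obtain k s where k: "ks = (k, s)"
    by (rule prod.exhaust)
  obtain m e where me: "normals ! k = (m, e)"
    by (rule prod.exhaust)
  have dot: "dot (permute_signed s m) x \<noteq> e"
      "\<And>y. y \<in> set (tight n d) \<Longrightarrow> y \<noteq> x \<Longrightarrow> dot (permute_signed s m) y = e"
    using ks unfolding k by (simp_all add: me)
  note s = neighbour_check [OF nbs(1) ks_in [unfolded k]]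
  have m: "(m, e) \<in> set normals"
    using s(1) me by (metis nth_mem)
  have "signed_permutation s (normal_of m e) \<bullet> point_of y = dot (permute_signed s m) y / e"
    if "y \<in> set (tight n d)" for y
    using that tight_subset length_points normals_length [OF m] signed_indices_length [OF s(2)]
    by (simp add: signed_permutation_normal_of [OF s(2)] inner_normal_of_point_of
        length_permute_signed subset_iff)
  then show thesis
    using that [OF neighbour_symmetry [OF nbs(1) ks_in [unfolded k]] m] dot x normals_pos [OF m] by simp
qed

section \<open>The assembled certificate and the vertex count\<close>

lemma certificate_6_48:
  "antipodal_certificate points_6_48
     (\<Union>g\<in>symmetries points_6_48. g ` (\<lambda>(n, d). normal_of n d) ` set normals) (sqrt (50 / 49))"
proof (rule antipodal_certificate_orbits)
  let ?N = "(\<lambda>(n, d). normal_of n d) ` set normals"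
  show "?N \<noteq> {}"
    by (simp add: normals_def)
  fix n v assume "n \<in> ?N"
  then obtain k d where k: "(k, d) \<in> set normals" "n = normal_of k d"
    by auto
  show "card {v \<in> points_6_48. n \<bullet> v = 1} = DIM(real ^ 6)"
    using card_facet_points [OF k(1)] k(2) by simp
  assume v: "v \<in> points_6_48"
  then obtain x where x: "x \<in> set points" "v = point_of x"
    by (auto simp: points_6_48_eq)
  show "n \<bullet> v \<le> 1"
    using normals_le [OF k(1) x(1)] normals_pos [OF k(1)] k x
    by (simp add: inner_normal_of_point_of normals_length length_points)
  assume "n \<bullet> v = 1"
  then have xt: "x \<in> set (tight k d)"
    using normal_of_eq_1_iff k x by simp
  have tight: "\<exists>y\<in>set (tight k d). w = point_of y" if "w \<in> points_6_48" "n \<bullet> w = 1" for w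
    using facet_points [OF k(1)] that k(2) by blast
  show "\<exists>g\<in>symmetries points_6_48. \<exists>m\<in>?N. g m \<bullet> v \<noteq> 1 \<and>
      (\<forall>w\<in>points_6_48. n \<bullet> w = 1 \<and> w \<noteq> v \<longrightarrow> g m \<bullet> w = 1)"
  proof -
    obtain g m e where g: "g \<in> symmetries points_6_48" "(m, e) \<in> set normals"
      "g (normal_of m e) \<bullet> point_of x \<noteq> 1"
      "\<And>y. y \<in> set (tight k d) \<Longrightarrow> y \<noteq> x \<Longrightarrow> g (normal_of m e) \<bullet> point_of y = 1"
      by (rule facet_neighbour [OF k(1) xt]) blast
    have "\<forall>w\<in>points_6_48. n \<bullet> w = 1 \<and> w \<noteq> v \<longrightarrow> g (normal_of m e) \<bullet> w = 1"
      using tight g(4) x(2) by blast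
    moreover have "normal_of m e \<in> ?N"
      using g(2) by force
    ultimately show ?thesis
      using g(1,3) x(2) by blast
  qed
  fix w assume w: "w \<in> points_6_48" "n \<bullet> w = 1"
  then obtain y where y: "y \<in> set (tight k d)" "w = point_of y"
    using tight by blast
  show "0 < v \<bullet> w"
    using inner_point_of_pos [OF _ _ tight_acute [OF k(1) xt y(1)]] length_points x y tight_subset
    by blast
qed (use finite_points_6_48 uminus_points_6_48 norm_points_6_48 in auto)

text \<open>Every class is represented in \<open>half_points\<close>, and by only one entry, because
  the 48 listed points are distinct.\<close>

lemma card_antipodal_classes: "card (antipodal_class ` points_6_48) = 24"
proof -
  have "antipodal_class ` points_6_48 = antipodal_class ` point_of ` set half_points"
    by (simp add: points_6_48_def half_points_6_48_eq image_Un image_image antipodal_class_def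
        insert_commute)
  moreover have "inj_on (\<lambda>x. antipodal_class (point_of x)) (set half_points)"
  proof
    fix x y assume xy: "x \<in> set half_points" "y \<in> set half_points"
      and "antipodal_class (point_of x) = antipodal_class (point_of y)"
    then have "point_of y = point_of x \<or> point_of y = point_of (map uminus x)"
      using half_points_subset length_points by (auto simp: antipodal_class_eq_iff point_of_uminus)
    moreover have "map uminus x \<in> set points"
      using xy(1) by (simp add: points_def)
    ultimately have "y = x \<or> y = map uminus x"
      using inj_on_point_of xy half_points_subset by (metis inj_onD subsetD)
    \<comment> \<open>The two halves of \<open>points\<close> are disjoint, and here
      \<open>y\<close> would lie in both.\<close>
    moreover have "y \<noteq> map uminus x"
      using check_points(1) xy by (auto simp: points_def)
    ultimately show "x = y"
      by simp
  qed
  moreover have "card (set half_points) = 24"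
    using check_points(1) by (simp add: points_def distinct_card) (simp add: half_points_def)
  ultimately show ?thesis
    by (simp add: image_image card_image)
qed

theorem theorem2p1:
  shows "centrally_symmetric polytope_6_48 \<and>
    simplicial_polytope polytope_6_48 \<and>
    aff_dim polytope_6_48 = 6 \<and>
    antipodal_identification_proper (boundary_complex polytope_6_48) \<and>
    card (complex_vertices (antipodal_quotient (boundary_complex polytope_6_48))) = 24 \<and>
    triangulates (antipodal_quotient (boundary_complex polytope_6_48))
      (real_projective_space :: (real ^ 6) set topology)"
proof -
  interpret antipodal_certificate points_6_48
    "\<Union>g\<in>symmetries points_6_48. g ` (\<lambda>(n, d). normal_of n d) ` set normals" "sqrt (50 / 49)"
    by (rule certificate_6_48)
  show ?thesis
    unfolding polytope_6_48_def
    using centrally_symmetric_hull simplicial_polytope_hull aff_dim_hull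
      antipodal_identification_proper_hull complex_vertices_antipodal_quotient
      card_antipodal_classes triangulates_hull
    by simp
qed

end
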